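(* Let $q=3^t$ with $t\ge 1$, let $Z_3=\mathbb{F}_{q^2}(x,y)$ be the function field defined by $x^q+x+(y+y^3+\cdots+y^{q/3})^2=0$, and put $p(b)=b+b^3+\cdots+b^{q/3}$. Let $a,b\in\mathbb{F}_{q^2}$ satisfy $a^q+a=0$ and $p(b)=0$, and let $P_{(a,b)}$ be the rational place of $Z_3$ with $x$-coordinate $a$ and $y$-coordinate $b$. Then $$H(P_{(a,b)})=\langle q,\ q+1,\ q-1,\ 2q-4\rangle .$$
   Context: $Z_3$ is a function field with full constant field $\mathbb{F}_{q^2}$ and genus $q(q-1)/6$. The functions $x$ and $y$ have a unique common pole $P_\infty$, a rational place, and no other poles. Every pair $(a,b)\in\mathbb{F}_{q^2}^2$ with $a^q+a+p(b)^2=0$ corresponds to a unique rational place $P_{(a,b)}\ne P_\infty$ with $x(P_{(a,b)})=a$, $y(P_{(a,b)})=b$. For a rational place $P$, the Weierstrass semigroup $H(P)$ is the set of non-negative integers $n$ for which there exists a function with pole divisor exactly $nP$. The notation $\langle a_1,\dots,a_r\rangle$ denotes the submonoid of $(\mathbb{Z}_{\ge 0},+)$ generated by $a_1,\dots,a_r$. *)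

theory Defs
  imports Complex_Main "HOL.Hull" "HOL-Computational_Algebra.Polynomial"
begin

text \<open>
  Function fields of one variable, following Stichtenoth, "Algebraic Function Fields and Codes".
  The function field is a type \<open>'f\<close> of class \<open>field\<close>; the constant field is a subfield
  \<open>K :: 'f set\<close>.
\<close>

definition is_subfield :: "'f::field set \<Rightarrow> bool" where
  "is_subfield L \<longleftrightarrow> 0 \<in> L \<and> 1 \<in> L \<and>
     (\<forall>u\<in>L. \<forall>v\<in>L. u + v \<in> L \<and> u - v \<in> L \<and> u * v \<in> L) \<and> (\<forall>u\<in>L. inverse u \<in> L)"

text \<open>\<open>adjoin K S\<close> is the field \<open>K(S)\<close>.\<close>

definition adjoin :: "'f::field set \<Rightarrow> 'f set \<Rightarrow> 'f set" where
  "adjoin K S = is_subfield hull (K \<union> S)"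

definition transcendental_over :: "'f::field set \<Rightarrow> 'f \<Rightarrow> bool" where
  "transcendental_over K z \<longleftrightarrow>
     (\<forall>f::'f poly. (\<forall>i. coeff f i \<in> K) \<longrightarrow> poly f z = 0 \<longrightarrow> f = 0)"

text \<open>The whole field \<open>'f\<close> is a finite-dimensional \<open>L\<close>-vector space.\<close>

definition finite_extension :: "'f::field set \<Rightarrow> bool" where
  "finite_extension L \<longleftrightarrow>
     (\<exists>B. finite B \<and> (\<forall>z. \<exists>c. (\<forall>b\<in>B. c b \<in> L) \<and> z = (\<Sum>b\<in>B. c b * b)))"

definition function_field :: "'f::field set \<Rightarrow> bool" where
  "function_field K \<longleftrightarrow> is_subfield K \<and>
     (\<exists>z. transcendental_over K z \<and> finite_extension (adjoin K {z}))"

definition valuation_ring :: "'f::field set \<Rightarrow> 'f set \<Rightarrow> bool" where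
  "valuation_ring K R \<longleftrightarrow> K \<subset> R \<and> R \<subset> UNIV \<and>
     (\<forall>u\<in>R. \<forall>v\<in>R. u + v \<in> R \<and> u - v \<in> R \<and> u * v \<in> R) \<and>
     (\<forall>z. z \<noteq> 0 \<longrightarrow> z \<in> R \<or> inverse z \<in> R)"

text \<open>A place is the maximal ideal, i.e. the set of non-units, of a valuation ring.\<close>

definition is_place :: "'f::field set \<Rightarrow> 'f set \<Rightarrow> bool" where
  "is_place K P \<longleftrightarrow>
     (\<exists>R. valuation_ring K R \<and> P = {z \<in> R. z = 0 \<or> inverse z \<notin> R})"

text \<open>
  The valuation ring is recovered from the place as \<open>{z. z = 0 \<or> inverse z \<notin> P}\<close>. Since
  \<open>inverse 0 = 0 \<in> P\<close>, the case \<open>z = 0\<close> has to be listed separately.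
\<close>

definition place_ring :: "'f::field set \<Rightarrow> 'f set" where
  "place_ring P = {z. z = 0 \<or> inverse z \<notin> P}"

definition prime_element :: "'f::field set \<Rightarrow> 'f \<Rightarrow> bool" where
  "prime_element P s \<longleftrightarrow> P = (\<lambda>r. s * r) ` place_ring P"

text \<open>
  The normalised discrete valuation \<open>v\<^sub>P\<close>, meaningful for \<open>z \<noteq> 0\<close> only;
  the value \<open>v\<^sub>P(0) = \<infinity>\<close> is never used.
\<close>

definition place_val :: "'f::field set \<Rightarrow> 'f \<Rightarrow> int" where
  "place_val P z =
     (THE n. \<exists>s u. prime_element P s \<and> u \<in> place_ring P - P \<and> z = s powi n * u)"

text \<open>The residue field at \<open>P\<close> equals \<open>K\<close>, i.e. \<open>P\<close> has degree one.\<close>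

definition rational_place :: "'f::field set \<Rightarrow> 'f set \<Rightarrow> bool" where
  "rational_place K P \<longleftrightarrow> is_place K P \<and> (\<forall>z\<in>place_ring P. \<exists>c\<in>K. z - c \<in> P)"

text \<open>\<open>z(P) = c\<close>: the residue class of \<open>z\<close> modulo \<open>P\<close> is the constant \<open>c\<close>.\<close>

definition has_value_at :: "'f::field set \<Rightarrow> 'f set \<Rightarrow> 'f \<Rightarrow> 'f \<Rightarrow> bool" where
  "has_value_at K P z c \<longleftrightarrow> z \<in> place_ring P \<and> c \<in> K \<and> z - c \<in> P"

text \<open>Divisors are integer-valued functions, zero off the set of places.\<close>

definition pole_divisor :: "'f::field set \<Rightarrow> 'f \<Rightarrow> 'f set \<Rightarrow> int" where
  "pole_divisor K z = (\<lambda>Q. if is_place K Q then max 0 (- place_val Q z) else 0)"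

definition place_multiple :: "nat \<Rightarrow> 'f set \<Rightarrow> 'f set \<Rightarrow> int" where
  "place_multiple n P = (\<lambda>Q. if Q = P then int n else 0)"

definition weierstrass_semigroup :: "'f::field set \<Rightarrow> 'f set \<Rightarrow> nat set" where
  "weierstrass_semigroup K P = {n. \<exists>z. z \<noteq> 0 \<and> pole_divisor K z = place_multiple n P}"

definition is_submonoid :: "nat set \<Rightarrow> bool" where
  "is_submonoid M \<longleftrightarrow> 0 \<in> M \<and> (\<forall>m\<in>M. \<forall>n\<in>M. m + n \<in> M)"

definition generated_submonoid :: "nat set \<Rightarrow> nat set" where
  "generated_submonoid A = is_submonoid hull A"

text \<open>\<open>p(b) = b + b\<^sup>3 + \<dots> + b\<^bsup>q/3\<^esup>\<close> for \<open>q = 3\<^sup>t\<close>.\<close>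

definition p_fun :: "nat \<Rightarrow> 'f::field \<Rightarrow> 'f" where
  "p_fun t b = (\<Sum>i<t. b ^ (3 ^ i))"

text \<open>
  \<open>'f = K(x,y)\<close> is the function field over the field \<open>K\<close> with \<open>q\<^sup>2\<close> elements, \<open>q = 3\<^sup>t\<close>,
  with the defining equation \<open>x\<^sup>q + x + p(y)\<^sup>2 = 0\<close>. This polynomial is
  irreducible over \<open>K\<close>, so the conditions determine \<open>(K, x, y)\<close> up to isomorphism.
\<close>

definition is_Z3 :: "nat \<Rightarrow> 'f::field set \<Rightarrow> 'f \<Rightarrow> 'f \<Rightarrow> bool" where
  "is_Z3 t K x y \<longleftrightarrow> function_field K \<and> card K = (3 ^ t)\<^sup>2 \<and> adjoin K {x, y} = UNIV \<and>
     x ^ (3 ^ t) + x + (p_fun t y)\<^sup>2 = 0"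

end

theory Submission
  imports Defs
begin

text \<open>
  Translating \<open>x\<close> by \<open>a\<close> and \<open>y\<close> by \<open>b\<close> preserves the equation of the curve, so it suffices to treat
  the place \<open>P\<close> at which \<open>x\<close> and \<open>y\<close> vanish, called the origin below. Write \<open>p = p(y)\<close>,
  \<open>Q = q/3\<close> and \<open>R = K[x,y]\<close>.

  The key is the function \<open>z = x\<^sup>3 - x\<^sup>2 + x + y\<^sup>2\<close>. From \<open>x\<^sup>q + x = -p\<^sup>2\<close> and \<open>y\<^sup>q - y = p\<^sup>3 - p\<close> one
  computes in characteristic three that
  \<open>z\<^sup>q + z + x\<^bsup>q+1\<^esup> + y\<^bsup>q+1\<^esup> = 0\<close> (\<open>hermitian\<close>). Hence \<open>z\<close> has a zero of order \<open>q + 1\<close> at the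
  origin and a pole of order \<open>q + 1\<close> at infinity. It has no other zeros (\<open>z_zero\<close>), so its divisor is
  \<open>(q + 1)(P - P\<^sub>\<infinity>)\<close>. Multiplication by a power of \<open>z\<close> therefore turns a function whose
  only pole is at the origin into one whose only poles are at infinity, and these form \<open>R\<close>
  (\<open>regular_outside_infinity_in_R\<close>). In \<open>R\<close> the monomials \<open>x\<^sup>i y\<^sup>j z\<^sup>k\<close> with \<open>j \<le> 1\<close> and
  \<open>2i + j \<le> q\<close> have the zero orders \<open>2i + j + (q+1)k\<close> at the origin and the pole orders
  \<open>Q(2i + 3j) + (q+1)k\<close> at infinity. Both lists are free of repetitions, and the second one
  contains every pole order of an element of \<open>R\<close>. So the monomials span
  \<open>R\<close> compatibly with the pole order at infinity (\<open>R_span_by_weight\<close>), and the order of an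
  element of \<open>R\<close> at the origin is the order of one of its monomials (\<open>span_lead\<close>). It follows
  that a positive pole number \<open>n\<close> at the origin has the form \<open>n = (q+1)m - (2i+j)\<close> with
  \<open>Q(2i+3j) \<le> (q+1)m\<close>, and an elementary estimate (\<open>pole_number_combination\<close>) puts all these
  numbers into the submonoid generated by \<open>q + 1\<close>, \<open>q\<close>, \<open>q - 1\<close> and \<open>2q - 4\<close>. Conversely these
  four are the pole numbers of \<open>1/z\<close>, \<open>y/z\<close>, \<open>x/z\<close> and \<open>x\<^sup>3/z\<^sup>2\<close>.

  It remains to explain why every place is discrete and why functions regular outside infinity lie
  in \<open>R\<close>. A place at infinity exists by Chevalley's extension theorem
  (\<open>exists_dominating_valring\<close>), and there \<open>y/z\<close> is a uniformizer. Its pole orders show that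
  \<open>R\<close> modulo a nonzero principal ideal is finite (\<open>R_pigeonhole\<close>). At a finite place the Frobenius
  map decides: if \<open>N\<close> is a power of \<open>|K|\<close> then \<open>g\<close> is congruent to \<open>g\<close> raised to the power
  \<open>N\<^sup>3\<close> modulo \<open>y\<^sup>N - y\<close>, for every \<open>g \<in> R\<close> (\<open>frobenius_fixes_residues\<close>). If \<open>g\<close> vanishes at the
  place then \<open>1 - g\<^sup>M\<close> with \<open>M = N\<^sup>3 - 1\<close> is a unit there, so \<open>g\<close> is a multiple of \<open>y\<^sup>N - y\<close> in the local
  ring. Hence \<open>y\<^sup>N - y\<close> is a uniformizer as soon as it vanishes at the place, and the local rings
  of \<open>R\<close> are discrete valuation rings.
\<close>

section \<open>Subrings and linear combinations\<close>

definition is_subring :: "'f::field set \<Rightarrow> bool" where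
  "is_subring B \<longleftrightarrow> 1 \<in> B \<and> (\<forall>u\<in>B. \<forall>v\<in>B. u + v \<in> B \<and> u - v \<in> B \<and> u * v \<in> B)"

lemma is_subringD:
  assumes "is_subring B"
  shows "1 \<in> B" "0 \<in> B" "u \<in> B \<Longrightarrow> v \<in> B \<Longrightarrow> u + v \<in> B" "u \<in> B \<Longrightarrow> v \<in> B \<Longrightarrow> u - v \<in> B"
    "u \<in> B \<Longrightarrow> v \<in> B \<Longrightarrow> u * v \<in> B" "u \<in> B \<Longrightarrow> - u \<in> B" "u \<in> B \<Longrightarrow> u ^ n \<in> B"
proof -
  show 1: "1 \<in> B" and add: "u \<in> B \<Longrightarrow> v \<in> B \<Longrightarrow> u + v \<in> B"
    and diff: "u \<in> B \<Longrightarrow> v \<in> B \<Longrightarrow> u - v \<in> B" and mult: "u \<in> B \<Longrightarrow> v \<in> B \<Longrightarrow> u * v \<in> B"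
    for u v using assms by (auto simp: is_subring_def)
  show 0: "0 \<in> B" using diff[OF 1 1] by simp
  show "u \<in> B \<Longrightarrow> - u \<in> B" using diff[OF 0, of u] by simp
  show "u \<in> B \<Longrightarrow> u ^ n \<in> B" by (induction n) (auto intro: 1 mult)
qed

lemma is_subring_sum:
  assumes "is_subring B" "\<And>i. i \<in> S \<Longrightarrow> g i \<in> B"
  shows "sum g S \<in> B"
  using assms(2)
  by (induction S rule: infinite_finite_induct) (auto intro: is_subringD[OF assms(1)])

text \<open>
  The ring \<open>B[w]\<close>.
\<close>

definition ring_adjoin :: "'f::field set \<Rightarrow> 'f \<Rightarrow> 'f set" where
  "ring_adjoin B w = {poly f w | f. \<forall>i. coeff f i \<in> B}"

lemma ring_adjoin_subring:
  assumes "is_subring B"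
  shows "is_subring (ring_adjoin B w)"
proof -
  note B = is_subringD[OF assms]
  have "\<forall>i. coeff (1::'a poly) i \<in> B"
    using B(1,2) by (auto simp: one_pCons coeff_pCons split: nat.split)
  hence one: "1 \<in> ring_adjoin B w" unfolding ring_adjoin_def by (auto intro!: exI[of _ 1])
  have "u + v \<in> ring_adjoin B w \<and> u - v \<in> ring_adjoin B w \<and> u * v \<in> ring_adjoin B w"
    if uv: "u \<in> ring_adjoin B w" "v \<in> ring_adjoin B w" for u v
  proof -
    obtain f g where f: "u = poly f w" "\<forall>i. coeff f i \<in> B" and g: "v = poly g w" "\<forall>i. coeff g i \<in> B"
      using uv unfolding ring_adjoin_def by blast
    have "\<forall>i. coeff (f + g) i \<in> B" "\<forall>i. coeff (f - g) i \<in> B" using f g B by auto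
    moreover have "\<forall>i. coeff (f * g) i \<in> B"
      unfolding coeff_mult using f(2) g(2) by (auto intro!: is_subring_sum[OF assms] B(5))
    moreover have "u + v = poly (f + g) w" "u - v = poly (f - g) w" "u * v = poly (f * g) w"
      using f g by auto
    ultimately show ?thesis unfolding ring_adjoin_def mem_Collect_eq by metis
  qed
  thus ?thesis using one unfolding is_subring_def by blast
qed

lemma ring_adjoin_base:
  assumes "is_subring B" shows "B \<subseteq> ring_adjoin B w" "w \<in> ring_adjoin B w"
proof -
  note B = is_subringD[OF assms]
  show "B \<subseteq> ring_adjoin B w"
  proof
    fix b assume "b \<in> B"
    hence "\<forall>i. coeff [:b:] i \<in> B" using B by (auto simp: coeff_pCons split: nat.split)
    thus "b \<in> ring_adjoin B w" unfolding ring_adjoin_def by (auto intro!: exI[of _ "[:b:]"])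
  qed
  have "\<forall>i. coeff [:0,1:] i \<in> B" using B by (auto simp: coeff_pCons split: nat.split)
  thus "w \<in> ring_adjoin B w" unfolding ring_adjoin_def by (auto intro!: exI[of _ "[:0,1:]"])
qed

lemma ring_adjoin_least:
  assumes "is_subring S" "B \<subseteq> S" "w \<in> S" shows "ring_adjoin B w \<subseteq> S"
proof
  fix u assume "u \<in> ring_adjoin B w"
  then obtain f where f: "u = poly f w" "\<forall>i. coeff f i \<in> B" unfolding ring_adjoin_def by blast
  show "u \<in> S" unfolding f(1) poly_altdef
    using f(2) assms(2,3) by (intro is_subring_sum[OF assms(1)] is_subringD(5,7)[OF assms(1)]) auto
qed

text \<open>
  Linear combinations of elements of \<open>I\<close> with coefficients in \<open>B\<close>. For \<open>I \<subseteq> B\<close> this is the ideal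
  that \<open>I\<close> generates in the ring \<open>B\<close>; for \<open>B = K\<close> it is the \<open>K\<close>-span of \<open>I\<close>. Both readings are used.
\<close>

inductive_set lincombs :: "'f::field set \<Rightarrow> 'f set \<Rightarrow> 'f set" for I B where
  zero: "0 \<in> lincombs I B"
| step: "i \<in> I \<Longrightarrow> b \<in> B \<Longrightarrow> u \<in> lincombs I B \<Longrightarrow> i * b + u \<in> lincombs I B"

lemma lincombs_add:
  assumes "u \<in> lincombs I B" "v \<in> lincombs I B" shows "u + v \<in> lincombs I B"
  using assms by (induction rule: lincombs.induct) (auto simp: add.assoc intro: lincombs.step)

lemma lincombs_mult:
  assumes "is_subring B" "u \<in> lincombs I B" "b \<in> B" shows "b * u \<in> lincombs I B"
  using assms(2)
proof induction
  case zero thus ?case by (simp add: lincombs.zero)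
next
  case (step i c u)
  have "b * (i * c + u) = i * (b * c) + b * u" by (simp add: algebra_simps)
  thus ?case using step assms(1,3) by (metis lincombs.step is_subringD(5))
qed

lemma lincombs_diff:
  assumes "is_subring B" "u \<in> lincombs I B" "v \<in> lincombs I B" shows "u - v \<in> lincombs I B"
  using lincombs_add[OF assms(2) lincombs_mult[OF assms(1,3), of "-1"]] is_subringD[OF assms(1)]
  by simp

lemma lincombs_sum:
  assumes "\<And>i. i \<in> S \<Longrightarrow> g i \<in> lincombs I B" shows "sum g S \<in> lincombs I B"
  using assms
  by (induction S rule: infinite_finite_induct) (auto intro: lincombs_add lincombs.zero)

lemma lincombs_subset:
  assumes "is_subring B" "I \<subseteq> B" shows "lincombs I B \<subseteq> B"
proof
  fix u assume "u \<in> lincombs I B" thus "u \<in> B"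
    by induction (use assms is_subringD[OF assms(1)] in auto)
qed

lemma lincombs_ring_adjoin:
  assumes "is_subring B" "I \<subseteq> B" "u \<in> lincombs I (ring_adjoin B w)"
  shows "\<exists>f. (\<forall>i. coeff f i \<in> lincombs I B) \<and> poly f w = u"
  using assms(3)
proof induction
  case zero show ?case by (rule exI[of _ 0]) (auto intro: lincombs.zero)
next
  case (step i b u)
  obtain f where f: "\<forall>i. coeff f i \<in> lincombs I B" "poly f w = u" using step by blast
  obtain g where g: "\<forall>i. coeff g i \<in> B" "b = poly g w" using step unfolding ring_adjoin_def by blast
  have "i * coeff g n + 0 \<in> lincombs I B" for n
    using g step(1) by (intro lincombs.step lincombs.zero) auto
  hence "\<forall>n. coeff (smult i g + f) n \<in> lincombs I B" using f by (auto intro!: lincombs_add)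
  thus ?case using f g by (intro exI[of _ "smult i g + f"]) auto
qed

lemma lincombs_map:
  assumes B: "is_subring B" and I: "\<And>b. b \<in> I \<Longrightarrow> b * w \<in> lincombs I' B" and u: "u \<in> lincombs I B"
  shows "u * w \<in> lincombs I' B"
  using u
proof induction
  case zero show ?case by (simp add: lincombs.zero)
next
  case (step i b u)
  have "(i * b + u) * w = b * (i * w) + u * w" by (simp add: algebra_simps)
  thus ?case using step I lincombs_mult[OF B] lincombs_add by metis
qed

lemma lincombs_mono:
  assumes "I \<subseteq> I'" shows "lincombs I B \<subseteq> lincombs I' B"
proof
  fix u assume "u \<in> lincombs I B" thus "u \<in> lincombs I' B"
    by induction (use assms in \<open>auto intro: lincombs.intros\<close>)
qed

lemma lincombs_base: "is_subring B \<Longrightarrow> i \<in> I \<Longrightarrow> i \<in> lincombs I B"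
  using lincombs.step[of i I 1 B 0] lincombs.zero is_subringD(1) by fastforce

text \<open>
  Collecting equal elements of \<open>I\<close> and discarding zero coefficients leaves summands that all have
  a genuine leading term at a place where the elements of \<open>I\<close> have one.
\<close>

lemma lincombs_sum_form:
  assumes B: "is_subring B" and u: "u \<in> lincombs I B"
  obtains T c where "finite T" "T \<subseteq> I" "\<forall>b\<in>T. c b \<in> B - {0}" "u = (\<Sum>b\<in>T. c b * b)"
proof -
  have "\<exists>T c. finite T \<and> T \<subseteq> I \<and> (\<forall>b\<in>T. c b \<in> B) \<and> u = (\<Sum>b\<in>T. c b * b)"
    using u
  proof induction
    case zero show ?case by (rule exI[of _ "{}"]) auto
  next
    case (step i b u)
    then obtain T c where T: "finite T" "T \<subseteq> I" "\<forall>b\<in>T. c b \<in> B" "u = (\<Sum>b\<in>T. c b * b)" by blast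
    define c' where "c' = c(i := b + (if i \<in> T then c i else 0))"
    have "(\<Sum>b\<in>insert i T. c' b * b) = c' i * i + (\<Sum>b\<in>T - {i}. c b * b)"
      using T(1) by (simp add: sum.insert_remove c'_def)
    also have "\<dots> = i * b + u"
      unfolding T(4) using T(1) by (auto simp: c'_def algebra_simps sum.remove[of T i])
    finally have "i * b + u = (\<Sum>b\<in>insert i T. c' b * b)" by simp
    moreover have "\<forall>b\<in>insert i T. c' b \<in> B"
      using T(3) step(2) is_subringD(2,3)[OF B] by (auto simp: c'_def)
    ultimately show ?case using T(1,2) step(1) by (intro exI[of _ "insert i T"] exI[of _ c']) auto
  qed
  then obtain T c where T: "finite T" "T \<subseteq> I" "\<forall>b\<in>T. c b \<in> B" "u = (\<Sum>b\<in>T. c b * b)" by blast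
  have "u = (\<Sum>b\<in>{b \<in> T. c b \<noteq> 0}. c b * b)"
    unfolding T(4) by (rule sum.mono_neutral_right) (use T(1) in auto)
  thus ?thesis using that[of "{b \<in> T. c b \<noteq> 0}" c] T by auto
qed

section \<open>Valuation rings dominating an ideal\<close>

lemma poly_sum_upto:
  fixes f :: "'f::field poly"
  assumes "degree f \<le> n" shows "poly f w = (\<Sum>i\<le>n. coeff f i * w ^ i)"
proof -
  have "poly f w = poly (\<Sum>i\<le>n. monom (coeff f i) i) w"
    by (simp only: poly_as_sum_of_monoms'[OF assms])
  thus ?thesis by (simp add: poly_sum poly_monom)
qed

text \<open>
  The constant coefficient of \<open>g\<close> lies in the ideal, so \<open>1\<close> minus it is a unit and the relation
  \<open>g(1/w) = 1\<close> can be solved for \<open>w\<^bsup>n+1\<^esup>\<close> in terms of lower powers, with coefficients in the ideal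
  up to that unit. Substituting this for the top power of \<open>w\<close> in \<open>f(w) = 1\<close> lowers the degree.
\<close>

lemma inverse_relation_degree_reduction:
  fixes w :: "'f::field"
  assumes B: "is_subring B" "I \<subseteq> B" and w: "w \<noteq> 0"
    and unit: "\<And>a. a \<in> lincombs I B \<Longrightarrow> inverse (1 - a) \<in> B"
    and proper: "1 \<notin> lincombs I B"
    and f: "\<forall>i. coeff f i \<in> lincombs I B" "degree f \<le> Suc n" "poly f w = 1"
    and g: "\<forall>i. coeff g i \<in> lincombs I B" "degree g \<le> Suc n" "poly g (inverse w) = 1"
  shows "\<exists>h. (\<forall>i. coeff h i \<in> lincombs I B) \<and> degree h \<le> n \<and> poly h w = 1"
proof -
  let ?J = "lincombs I B"
  have sumf: "(\<Sum>i\<le>Suc n. coeff f i * w ^ i) = 1"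
    using poly_sum_upto[OF f(2)] f(3) by simp
  have sumg: "(\<Sum>i\<le>Suc n. coeff g i * inverse w ^ i) = 1"
    using poly_sum_upto[OF g(2)] g(3) by simp
  define u where "u = inverse (1 - coeff g 0)"
  have g0: "1 - coeff g 0 \<noteq> 0" using proper g(1) by (metis eq_iff_diff_eq_0)
  have uB: "u \<in> B" unfolding u_def using unit g(1) by blast
  have "(\<Sum>i\<le>Suc n. coeff g i * inverse w ^ i) * w ^ Suc n = (\<Sum>i\<le>Suc n. coeff g i * w ^ (Suc n - i))"
    unfolding sum_distrib_right
    by (rule sum.cong) (use w in \<open>auto simp: power_diff power_inverse divide_inverse mult.assoc
        simp del: power_Suc intro!: arg_cong2[of _ _ _ _ "(*)"]\<close>)
  also have "\<dots> = coeff g 0 * w ^ Suc n + (\<Sum>i\<le>n. coeff g (Suc i) * w ^ (n - i))"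
    by (subst sum.atMost_Suc_shift) simp
  finally have "w ^ Suc n = coeff g 0 * w ^ Suc n + (\<Sum>i\<le>n. coeff g (Suc i) * w ^ (n - i))"
    by (simp only: sumg mult_1_left)
  moreover have "W = c * W + S \<Longrightarrow> (1 - c) * W = S" for W c S :: 'f by algebra
  ultimately have "(1 - coeff g 0) * w ^ Suc n = (\<Sum>i\<le>n. coeff g (Suc i) * w ^ (n - i))" by blast
  moreover have "d \<noteq> 0 \<Longrightarrow> d * W = S \<Longrightarrow> W = inverse d * S" for d W S :: 'f by auto
  ultimately have wn: "w ^ Suc n = u * (\<Sum>i\<le>n. coeff g (Suc i) * w ^ (n - i))"
    using g0 unfolding u_def by blast
  define c where "c = coeff f (Suc n) * u"
  define h where "h = (\<Sum>i\<le>n. monom (coeff f i) i) + (\<Sum>i\<le>n. monom (c * coeff g (Suc i)) (n - i))"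
  have cB: "c \<in> ?J" unfolding c_def using uB f(1) lincombs_mult[OF B(1)] by (metis mult.commute)
  have fB: "coeff f i \<in> ?J" for i using f(1) by blast
  have cg: "c * coeff g i \<in> ?J" for i
  proof -
    have "coeff f (Suc n) * (u * coeff g i) \<in> ?J" 
      using fB g(1) uB lincombs_mult[OF B(1)] lincombs_subset[OF B]
      by (metis is_subringD(5)[OF B(1)] mult.commute subsetD)
    thus ?thesis unfolding c_def by (simp add: mult.assoc)
  qed
  have "poly h w = (\<Sum>i\<le>n. coeff f i * w ^ i) + c * (\<Sum>i\<le>n. coeff g (Suc i) * w ^ (n - i))"
    unfolding h_def by (simp add: poly_sum poly_monom sum_distrib_left mult.assoc)
  also have "\<dots> = (\<Sum>i\<le>Suc n. coeff f i * w ^ i)"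
    by (simp only: c_def mult.assoc wn[symmetric] sum.atMost_Suc)
  also have "\<dots> = 1" by (rule sumf)
  finally have "poly h w = 1" .
  moreover have "degree h \<le> n" unfolding h_def
    by (intro degree_add_le degree_sum_le) (auto intro: order.trans[OF degree_monom_le])
  moreover have "coeff h i \<in> ?J" for i unfolding h_def coeff_add coeff_sum
    by (intro lincombs_add lincombs_sum) (auto simp: lincombs.zero cg fB)
  ultimately show ?thesis by blast
qed

text \<open>
  Reducing the relation of larger degree by the other one never stops before one of them becomes
  constant, and a constant relation says that the ideal is improper.
\<close>

lemma inverse_relation_contradiction:
  fixes w :: "'f::field"
  assumes B: "is_subring B" "I \<subseteq> B"
    and unit: "\<And>a. a \<in> lincombs I B \<Longrightarrow> inverse (1 - a) \<in> B"
    and proper: "1 \<notin> lincombs I B"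
    and w: "w \<noteq> 0"
    and f: "\<forall>i. coeff f i \<in> lincombs I B" "poly f w = 1"
    and g: "\<forall>i. coeff g i \<in> lincombs I B" "poly g (inverse w) = 1"
  shows False
  using w f g
proof (induction "degree f + degree g" arbitrary: w f g rule: less_induct)
  case less
  have pos: "degree h > 0" if "\<forall>i. coeff h i \<in> lincombs I B" "poly h v = 1" for h v
  proof (rule ccontr)
    assume "\<not> degree h > 0"
    then obtain c where "h = [:c:]" by (metis degree_eq_zeroE gr0I)
    hence "1 = coeff h 0" using that by simp
    thus False using that proper by metis
  qed
  have *: False if hk: "v \<noteq> 0" "\<forall>i. coeff h i \<in> lincombs I B" "poly h v = 1"
     "\<forall>i. coeff k i \<in> lincombs I B" "poly k (inverse v) = 1"
     "degree k \<le> degree h" "degree h + degree k = degree f + degree g" for h k v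
  proof -
    obtain n where n: "degree h = Suc n" using pos[OF hk(2,3)] by (metis gr0_conv_Suc)
    obtain h' where "\<forall>i. coeff h' i \<in> lincombs I B" "degree h' \<le> n" "poly h' v = 1"
      using inverse_relation_degree_reduction[OF B hk(1) unit proper hk(2) _ hk(3,4) _ hk(5), of n]
        n hk(6) by auto
    moreover from this have "degree h' + degree k < degree f + degree g"
      using n hk(7) by linarith
    ultimately show False using less(1)[of h' k v] hk by blast
  qed
  show False
  proof (cases "degree g \<le> degree f")
    case True thus False using *[of w f g] less(2-) by simp
  next
    case False thus False using *[of "inverse w" g f] less(2-) by simp
  qed
qed

definition is_valring :: "'f::field set \<Rightarrow> bool" where
  "is_valring O' \<longleftrightarrow> is_subring O' \<and> (\<forall>z. z \<in> O' \<or> inverse z \<in> O')"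

definition max_ideal :: "'f::field set \<Rightarrow> 'f set" where
  "max_ideal O' = {z \<in> O'. z = 0 \<or> inverse z \<notin> O'}"

text \<open>
  Chevalley's extension theorem. Zorn's lemma gives a maximal ring \<open>B\<close> among those in which \<open>I\<close>
  still generates a proper ideal. An element \<open>w \<notin> B\<close> makes this ideal improper in \<open>B[w]\<close>, which is a
  polynomial relation for \<open>w\<close> with coefficients in the ideal; by
  \<open>inverse_relation_contradiction\<close>, \<open>w\<close> and \<open>1/w\<close> cannot both have one.
\<close>

theorem exists_dominating_valring:
  fixes A :: "'f::field set"
  assumes A: "is_subring A" "I \<subseteq> A" and proper: "1 \<notin> lincombs I A"
  shows "\<exists>O'. is_valring O' \<and> A \<subseteq> O' \<and> I \<subseteq> max_ideal O'"
proof -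
  define F where "F = {B. is_subring B \<and> A \<subseteq> B \<and> 1 \<notin> lincombs I B}"
  have "\<exists>M\<in>F. \<forall>X\<in>F. M \<subseteq> X \<longrightarrow> X = M"
  proof (rule subset_Zorn_nonempty)
    show "F \<noteq> {}" using A proper unfolding F_def by blast
  next
    fix C assume C: "C \<noteq> {}" "subset.chain F C"
    have CF: "C \<subseteq> F" using C by (simp add: subset_chain_def)
    have dir: "\<exists>Z\<in>C. X \<subseteq> Z \<and> Y \<subseteq> Z" if "X \<in> C" "Y \<in> C" for X Y
    proof -
      have "X \<subseteq> Y \<or> Y \<subseteq> X" using C(2) that by (simp add: subset_chain_def)
      thus ?thesis using that by blast
    qed
    have id: "\<exists>B\<in>C. u \<in> lincombs I B" if "u \<in> lincombs I (\<Union>C)" for u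
      using that
    proof induction
      case zero thus ?case using C(1) lincombs.zero by blast
    next
      case (step i b u)
      then obtain X Y where XY: "X \<in> C" "b \<in> X" "Y \<in> C" "u \<in> lincombs I Y" by blast
      obtain Z where Z: "Z \<in> C" "X \<subseteq> Z" "Y \<subseteq> Z" using dir XY by metis
      have "u \<in> lincombs I Z"
        using XY(4) by induction (use Z(3) in \<open>auto intro: lincombs.intros\<close>)
      thus ?case using Z XY step(1) by (metis lincombs.step subsetD)
    qed
    have "is_subring (\<Union>C)" unfolding is_subring_def
    proof (intro conjI ballI)
      show "1 \<in> \<Union>C" using C(1) CF is_subringD(1) unfolding F_def by blast
    next
      fix u v assume uv: "u \<in> \<Union>C" "v \<in> \<Union>C"
      then obtain Z where Z: "Z \<in> C" "u \<in> Z" "v \<in> Z" using dir by blast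
      have "is_subring Z" using Z CF F_def by blast
      thus "u + v \<in> \<Union>C" "u - v \<in> \<Union>C" "u * v \<in> \<Union>C" using Z is_subringD(3-5) by blast+
    qed
    moreover have "A \<subseteq> \<Union>C" using C(1) CF unfolding F_def by blast
    moreover have "1 \<notin> lincombs I (\<Union>C)" using id CF unfolding F_def by blast
    ultimately show "\<Union>C \<in> F" unfolding F_def by blast
  qed
  then obtain B where BF: "B \<in> F" and Bmax: "\<forall>X\<in>F. B \<subseteq> X \<longrightarrow> X = B" by blast
  have B: "is_subring B" "A \<subseteq> B" "1 \<notin> lincombs I B" using BF unfolding F_def by simp_all
  have max: "X = B" if "is_subring X" "B \<subseteq> X" "1 \<notin> lincombs I X" for X
    using Bmax that B(2) unfolding F_def by auto
  have IB: "I \<subseteq> B" using A B by blast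
  let ?J = "lincombs I B"
  have rel: "\<exists>f. (\<forall>i. coeff f i \<in> ?J) \<and> poly f w = 1" if "w \<notin> B" for w
  proof -
    have "1 \<in> lincombs I (ring_adjoin B w)"
      using max[OF ring_adjoin_subring[OF B(1)] ring_adjoin_base(1)[OF B(1)]] ring_adjoin_base(2)[OF B(1)] that
      by blast
    thus ?thesis by (rule lincombs_ring_adjoin[OF B(1) IB])
  qed
  have unit: "inverse (1 - a) \<in> B" if a: "a \<in> ?J" for a
  proof (rule ccontr)
    define u where "u = 1 - a"
    assume "inverse (1 - a) \<notin> B"
    then obtain f where f: "\<forall>i. coeff f i \<in> ?J" "poly f (inverse u) = 1" using rel u_def by blast
    have u0: "u \<noteq> 0" using a B(3) u_def by auto
    have uB: "u \<in> B" using a lincombs_subset[OF B(1) IB] is_subringD[OF B(1)] u_def by blast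
    define n where "n = degree f"
    have "u ^ n = poly f (inverse u) * u ^ n" using f by simp
    also have "\<dots> = (\<Sum>i\<le>n. coeff f i * inverse u ^ i * u ^ n)"
      by (simp add: poly_altdef n_def sum_distrib_right)
    also have "\<dots> = (\<Sum>i\<le>n. u ^ (n - i) * coeff f i)"
      by (rule sum.cong) (use u0 in \<open>auto simp: power_diff power_inverse field_simps\<close>)
    also have "\<dots> \<in> ?J"
      using f uB by (intro lincombs_sum lincombs_mult[OF B(1)] is_subringD(7)[OF B(1)]) auto
    finally have un: "u ^ n \<in> ?J" .
    \<comment> \<open>Modulo the ideal, \<open>u\<close> is \<open>1\<close>, whereas the relation for \<open>1/u\<close> puts \<open>u\<^sup>n\<close> into the ideal.\<close>
    have "1 - u ^ m \<in> ?J" for m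
    proof (induction m)
      case (Suc m)
      have "1 - u ^ Suc m = a + u * (1 - u ^ m)" by (simp add: u_def algebra_simps)
      thus ?case using Suc a uB lincombs_add lincombs_mult[OF B(1)] by metis
    qed (simp add: lincombs.zero)
    from lincombs_add[OF this[of n] un] have "1 \<in> ?J" by simp
    thus False using B(3) by blast
  qed
  have "w \<in> B \<or> inverse w \<in> B" for w
  proof (cases "w = 0")
    case True thus ?thesis using is_subringD(2)[OF B(1)] by simp
  next
    case False
    thus ?thesis using rel[of w] rel[of "inverse w"]
      inverse_relation_contradiction[OF B(1) IB unit B(3) False] by blast
  qed
  hence "is_valring B" using B(1) unfolding is_valring_def by blast
  moreover have "I \<subseteq> max_ideal B"
  proof
    fix i assume i: "i \<in> I"
    have "inverse i \<notin> B" if "i \<noteq> 0"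
    proof
      assume "inverse i \<in> B"
      from lincombs.step[OF i this lincombs.zero] show False using that B(3) by simp
    qed
    thus "i \<in> max_ideal B" using i IB unfolding max_ideal_def by blast
  qed
  ultimately show ?thesis using B(2) by blast
qed

section \<open>Discrete valuations and leading terms\<close>

locale valring =
  fixes V :: "'f::field set"
  assumes valring: "is_valring V"
begin

abbreviation mm where "mm \<equiv> max_ideal V"

lemma subring: "is_subring V" using valring by (simp add: is_valring_def)

lemmas V_one = is_subringD(1)[OF subring]
  and V_zero = is_subringD(2)[OF subring]
  and V_add = is_subringD(3)[OF subring]
  and V_diff = is_subringD(4)[OF subring]
  and V_mult = is_subringD(5)[OF subring]
  and V_minus = is_subringD(6)[OF subring]
  and V_power = is_subringD(7)[OF subring]

lemma dichotomy: "z \<in> V \<or> inverse z \<in> V" using valring by (auto simp: is_valring_def)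

lemma mm_V: "z \<in> mm \<Longrightarrow> z \<in> V" by (simp add: max_ideal_def)

lemma zero_mm: "0 \<in> mm" using V_zero by (simp add: max_ideal_def)

lemma one_notin_mm: "1 \<notin> mm" using V_one by (simp add: max_ideal_def)

lemma inverse_mm: "z \<notin> V \<Longrightarrow> inverse z \<in> mm"
  using dichotomy[of z] by (simp add: max_ideal_def)

lemma mm_mult:
  assumes "a \<in> mm" "b \<in> V" shows "a * b \<in> mm"
proof -
  have "inverse (a * b) \<notin> V" if "a * b \<noteq> 0"
  proof
    assume "inverse (a * b) \<in> V"
    hence "inverse (a * b) * b \<in> V" using V_mult assms by blast
    moreover have "inverse (a * b) * b = inverse a" using that by (simp add: field_simps)
    ultimately have "inverse a \<in> V" by (simp only:)
    thus False using that assms by (simp add: max_ideal_def)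
  qed
  thus ?thesis using assms V_mult by (auto simp: max_ideal_def)
qed

lemma mm_mult2: "a \<in> V \<Longrightarrow> b \<in> mm \<Longrightarrow> a * b \<in> mm"
  using mm_mult[of b a] by (simp add: mult.commute)

lemma mm_add:
  assumes "a \<in> mm" "b \<in> mm" shows "a + b \<in> mm"
proof -
  have *: "a + b \<in> mm" if ab: "a \<in> mm" "b \<in> mm" "a \<noteq> 0" "b * inverse a \<in> V" for a b
  proof -
    have "a * (1 + b * inverse a) \<in> mm" using ab mm_mult V_add V_one by blast
    moreover have "a * (1 + b * inverse a) = a + b" using ab by (simp add: field_simps)
    ultimately show ?thesis by simp
  qed
  show ?thesis
  proof (cases "a = 0 \<or> b = 0")
    case True thus ?thesis using assms by auto
  next
    case False
    have "inverse (b * inverse a) = a * inverse b" using False by simp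
    thus ?thesis using *[of a b] *[of b a] assms False dichotomy[of "b * inverse a"]
      by (metis add.commute)
  qed
qed

lemma mm_minus: "a \<in> mm \<Longrightarrow> - a \<in> mm"
  using mm_mult[of a "-1"] V_minus[OF V_one] by simp

lemma mm_diff: "a \<in> mm \<Longrightarrow> b \<in> mm \<Longrightarrow> a - b \<in> mm"
  using mm_add[of a "-b"] mm_minus by simp

lemma mm_sum: "(\<And>i. i \<in> S \<Longrightarrow> g i \<in> mm) \<Longrightarrow> sum g S \<in> mm"
  by (induction S rule: infinite_finite_induct) (auto intro: mm_add zero_mm)

lemma mm_power: "a \<in> mm \<Longrightarrow> n > 0 \<Longrightarrow> a ^ n \<in> mm"
  by (cases n) (auto intro: mm_mult V_power mm_V)

definition units where "units = {u \<in> V. u \<notin> mm}"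

lemma units_iff: "u \<in> units \<longleftrightarrow> u \<noteq> 0 \<and> u \<in> V \<and> inverse u \<in> V"
  using V_zero by (auto simp: units_def max_ideal_def)

lemma units_mult: "u \<in> units \<Longrightarrow> v \<in> units \<Longrightarrow> u * v \<in> units"
  by (simp add: units_iff V_mult)

lemma units_inverse: "u \<in> units \<Longrightarrow> inverse u \<in> units"
  by (simp add: units_iff)

lemma units_divide: "u \<in> units \<Longrightarrow> v \<in> units \<Longrightarrow> u / v \<in> units"
  using units_mult units_inverse by (simp add: divide_inverse)

lemma units_power: "u \<in> units \<Longrightarrow> u ^ n \<in> units"
  by (induction n) (auto simp: units_mult units_iff V_one V_mult)

lemma units_powi: "u \<in> units \<Longrightarrow> u powi n \<in> units"
  by (simp add: power_int_def units_power units_inverse)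

lemma one_unit: "1 \<in> units" by (simp add: units_iff V_one)

lemma units_minus: "u \<in> units \<Longrightarrow> - u \<in> units"
  by (auto simp: units_iff inverse_minus_eq V_minus)

lemma units_add_mm:
  assumes "u \<in> units" "a \<in> mm" shows "u + a \<in> units"
proof -
  have "u + a \<notin> mm" using mm_diff[of "u + a" a] assms by (auto simp: units_def)
  thus ?thesis using assms V_add mm_V by (auto simp: units_def)
qed

text \<open>
  An element outside \<open>V\<close> has all its powers outside \<open>V\<close>. In characteristic three this lemma extracts
  congruences between functions from congruences between their \<open>3\<^sup>n\<close>-th powers.
\<close>

lemma mm_root: "a ^ n \<in> mm \<Longrightarrow> a \<in> mm"
proof -
  assume a: "a ^ n \<in> mm"
  have n: "n > 0" using a one_notin_mm by (cases n) auto
  have "a \<in> V"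
  proof (rule ccontr)
    assume "a \<notin> V"
    hence "inverse a ^ n \<in> mm" "a \<noteq> 0" using inverse_mm mm_power n V_zero by blast+
    hence "a ^ n * inverse a ^ n \<in> mm" using a mm_mult mm_V by blast
    thus False using \<open>a \<noteq> 0\<close> one_notin_mm by (simp add: power_inverse)
  qed
  thus ?thesis using a units_power[of a n] by (auto simp: units_def)
qed

lemma not_V_mult_unit: "a \<notin> V \<Longrightarrow> u \<in> units \<Longrightarrow> a * u \<notin> V"
  using V_mult[of "a * u" "inverse u"] by (auto simp: units_iff mult.assoc)

lemma not_V_power: "a \<notin> V \<Longrightarrow> n > 0 \<Longrightarrow> a ^ n \<notin> V"
proof
  assume a: "a \<notin> V" "n > 0" "a ^ n \<in> V"
  have "a \<noteq> 0" using a V_zero by auto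
  have "a ^ n * inverse a ^ n \<in> mm" using a mm_mult2 mm_power inverse_mm by blast
  thus False using \<open>a \<noteq> 0\<close> one_notin_mm by (simp add: power_inverse)
qed

text \<open>
  The expansion of \<open>g\<close> in powers of \<open>s\<close> starts with \<open>c s\<^sup>e\<close>. The coefficient \<open>c\<close> may be \<open>0\<close>: then
  the order of \<open>g\<close> exceeds \<open>e\<close>.
\<close>

definition lead :: "'f \<Rightarrow> 'f \<Rightarrow> int \<Rightarrow> 'f \<Rightarrow> bool" where
  "lead s g e c \<longleftrightarrow> g * s powi (- e) - c \<in> mm"

context
  fixes s :: 'f
  assumes s: "s \<in> mm" "s \<noteq> 0"
begin

lemma lead_mult:
  assumes "lead s g e c" "lead s h d b" "c \<in> V" "b \<in> V"
  shows "lead s (g * h) (e + d) (c * b)"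
proof -
  let ?g = "g * s powi (- e)" and ?h = "h * s powi (- d)"
  have "(g * h) * s powi (- (e + d)) = ?g * ?h"
    using s by (simp add: power_int_diff power_int_minus power_int_add field_simps)
  hence "(g * h) * s powi (- (e + d)) - c * b = (?g - c) * (?h - b) + (c * (?h - b) + (?g - c) * b)"
    by (simp add: algebra_simps)
  also have "\<dots> \<in> mm"
    using assms unfolding lead_def by (intro mm_add mm_mult2 mm_mult) (auto intro: mm_V)
  finally show ?thesis by (simp add: lead_def)
qed

lemma lead_one: "lead s 1 0 1" by (simp add: lead_def zero_mm)

lemma lead_const: "lead s c 0 c" by (simp add: lead_def zero_mm)

lemma lead_self: "lead s s 1 1" using s by (simp add: lead_def zero_mm power_int_minus)

lemma lead_power:
  assumes "lead s g e c" "c \<in> V"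
  shows "lead s (g ^ n) (int n * e) (c ^ n)"
proof (induction n)
  case 0 show ?case by (simp add: lead_one)
next
  case (Suc n)
  show ?case using lead_mult[OF assms(1) Suc assms(2) V_power[OF assms(2)]]
    by (simp add: algebra_simps)
qed

lemma s_powi_mm: "n > 0 \<Longrightarrow> s powi n \<in> mm"
  using mm_power[OF s(1), of "nat n"] by (simp add: power_int_def)

lemma lead_higher:
  assumes "lead s g e c" "c \<in> V" "d < e" shows "lead s g d 0"
proof -
  have "g * s powi (- e) \<in> V"
    using V_add[OF mm_V[OF assms(1)[unfolded lead_def]] assms(2)] by simp
  hence "(g * s powi (- e)) * s powi (e - d) \<in> mm" using s_powi_mm assms(3) mm_mult2 by auto
  thus ?thesis using s by (simp add: lead_def mult.assoc flip: power_int_add)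
qed

lemma lead_add: "lead s g e c \<Longrightarrow> lead s h e b \<Longrightarrow> lead s (g + h) e (c + b)"
  using mm_add[of "g * s powi (- e) - c" "h * s powi (- e) - b"]
  by (simp add: lead_def algebra_simps)

text \<open>
  With distinct exponents, the term of least exponent cannot be cancelled.
\<close>

lemma lead_sum:
  assumes "finite T" "T \<noteq> {}" "inj_on e T"
    and "\<And>i. i \<in> T \<Longrightarrow> lead s (g i) (e i) (c i)" "\<And>i. i \<in> T \<Longrightarrow> c i \<in> V"
  shows "\<exists>j\<in>T. lead s (sum g T) (e j) (c j)"
proof -
  obtain j where j: "j \<in> T" "e j = Min (e ` T)"
    using Min_in[of "e ` T"] assms(1,2) by (metis (no_types, lifting) finite_imageI imageE image_is_empty)
  have zero: "lead s (g i) (e j) 0" if "i \<in> T - {j}" for i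
  proof -
    have "e j \<le> e i" using that j assms(1) by auto
    moreover have "e i \<noteq> e j" using that j(1) inj_onD[OF assms(3), of i j] by auto
    ultimately show ?thesis using that assms(4,5) lead_higher[of "g i" "e i" "c i" "e j"] by auto
  qed
  have "lead s (sum g (T - {j})) (e j) 0"
    using zero unfolding lead_def by (auto simp: sum_distrib_right intro!: mm_sum)
  from lead_add[OF assms(4)[OF j(1)] this] have "lead s (sum g T) (e j) (c j)"
    using assms(1) j by (simp add: sum.remove)
  thus ?thesis using j by blast
qed

lemma lead_unit:
  assumes "lead s g e c" "c \<in> units"
  shows "\<exists>u\<in>units. g = s powi e * u"
proof -
  have "c + (g * s powi (- e) - c) \<in> units"
    using assms units_add_mm unfolding lead_def by blast
  hence "g * s powi (- e) \<in> units" by simp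
  thus ?thesis using s by (intro bexI[of _ "g * s powi (- e)"]) (auto simp: power_int_minus)
qed

end

lemma lead_exponent_less:
  assumes s: "s \<in> mm" "s \<noteq> 0" and "lead s g e c" "c \<in> units" "lead s g d 0"
  shows "d < e"
proof (rule ccontr)
  assume "\<not> d < e"
  hence "lead s g e 0"
    using lead_higher[OF s assms(5), of e] assms(5) V_zero by (cases "d = e") auto
  hence "g * s powi (- e) - 0 - (g * s powi (- e) - c) \<in> mm"
    using assms(3) mm_diff unfolding lead_def by blast
  thus False using assms(4) by (simp add: units_def)
qed

lemma lead_exponent_unique:
  assumes s: "s \<in> mm" "s \<noteq> 0" and "lead s g e c" "c \<in> units" "lead s g d b" "b \<in> units"
  shows "e = d"
proof (rule ccontr)
  have V: "c \<in> V" "b \<in> V" using assms units_iff by auto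
  assume "e \<noteq> d"
  then consider "e < d" | "d < e" by linarith
  thus False
  proof cases
    case 1
    hence "lead s g e 0" by (rule lead_higher[OF s assms(5) V(2)])
    thus False using lead_exponent_less[OF s assms(3,4)] by blast
  next
    case 2
    hence "lead s g d 0" by (rule lead_higher[OF s assms(3) V(1)])
    thus False using lead_exponent_less[OF s assms(5,6)] by blast
  qed
qed

lemma lead_cancel:
  assumes s: "s \<in> mm" "s \<noteq> 0" and K: "is_subfield K" "K \<subseteq> V"
    and g: "lead s g e c" "c \<in> K" and m: "lead s m e d" "d \<in> K - {0}"
  shows "lead s (g - c / d * m) e 0"
proof -
  have "- (c / d) \<in> K"
    using g m K by (simp add: is_subfield_def divide_inverse) (metis diff_0)
  hence "lead s (- (c / d) * m) e (- (c / d) * d)"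
    using lead_mult[OF s lead_const[OF s, of "- (c / d)"] m(1)] K m by auto
  from lead_add[OF s g(1) this] show ?thesis using m(2) by simp
qed

text \<open>
  All congruences \<open>u/w \<equiv> -1\<close> below arise in this way from the equations \<open>x\<^sup>q + x = -p\<^sup>2\<close> and
  \<open>z\<^sup>q + z = -(x\<^bsup>q+1\<^esup> + y\<^bsup>q+1\<^esup>)\<close>, after factoring out the dominant term on each side.
\<close>

lemma unit_quotient:
  assumes "a \<in> mm" "b \<in> mm" "u * (1 + b) = - (w * (1 + a))" "w \<noteq> 0"
  shows "u / w + 1 \<in> mm"
proof -
  have b: "1 + b \<in> units" using units_add_mm one_unit assms by blast
  hence "u = - (w * (1 + a)) / (1 + b)" using assms(3) units_iff eq_divide_imp by blast
  hence "u / w = - ((1 + a) / (1 + b))" using assms(4) by simp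
  moreover have "1 + b \<noteq> 0" using b units_iff by blast
  hence "- ((1 + a) / (1 + b)) + 1 = (b - a) * inverse (1 + b)" by (simp add: field_simps)
  ultimately have "u / w + 1 = (b - a) * inverse (1 + b)" by simp
  thus ?thesis using mm_mult mm_diff assms b units_iff by simp
qed

text \<open>
  An element of a span whose generators have distinct orders has the order of one of the
  generators. The order is given by a relation \<open>E\<close> since for monomials it is read off from the
  exponents and not from the field element.
\<close>

lemma lincombs_lead:
  assumes s: "s \<in> mm" "s \<noteq> 0" and K: "is_subring K" "K \<subseteq> V"
    and dom: "\<And>c d. c \<in> K - {0} \<Longrightarrow> d \<in> K - {0} \<Longrightarrow> c * d \<in> K - {0}"
    and E: "\<And>b. b \<in> I \<Longrightarrow> \<exists>e. E b e"
    and lead: "\<And>b e. b \<in> I \<Longrightarrow> E b e \<Longrightarrow> \<exists>c\<in>K - {0}. lead s b e c"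
    and inj: "\<And>b b' e. b \<in> I \<Longrightarrow> b' \<in> I \<Longrightarrow> E b e \<Longrightarrow> E b' e \<Longrightarrow> b = b'"
    and u: "u \<in> lincombs I K" "u \<noteq> 0"
  shows "\<exists>b\<in>I. \<exists>e. E b e \<and> (\<exists>c\<in>K - {0}. lead s u e c)"
proof -
  obtain T c where T: "finite T" "T \<subseteq> I" "\<forall>b\<in>T. c b \<in> K - {0}" "u = (\<Sum>b\<in>T. c b * b)"
    using lincombs_sum_form[OF K(1) u(1)] .
  have "\<forall>b\<in>T. \<exists>e. E b e" using E T(2) by blast
  then obtain e where e: "\<forall>b\<in>T. E b (e b)" by metis
  have "\<forall>b\<in>T. \<exists>c\<in>K - {0}. lead s b (e b) c" using lead e T(2) by blast
  then obtain d where d: "\<forall>b\<in>T. d b \<in> K - {0} \<and> lead s b (e b) (d b)" by metis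
  have "\<exists>j\<in>T. lead s (\<Sum>b\<in>T. c b * b) (e j) (c j * d j)"
  proof (rule lead_sum[OF s T(1)])
    show "T \<noteq> {}" using T(4) u(2) by auto
    show "inj_on e T"
    proof (rule inj_onI)
      fix b b' assume "b \<in> T" "b' \<in> T" "e b = e b'"
      hence "b \<in> I" "b' \<in> I" "E b (e b)" "E b' (e b)" using e T(2) by (auto simp: subset_iff)
      thus "b = b'" using inj by blast
    qed
  next
    fix b assume b: "b \<in> T"
    have cb: "c b \<in> V" "d b \<in> V" using T(3) d b K(2) by auto
    show "lead s (c b * b) (e b) (c b * d b)"
      using lead_mult[OF s lead_const[OF s, of "c b"], of b "e b" "d b"] d b cb by simp
    show "c b * d b \<in> V" using cb V_mult by blast
  qed
  then obtain j where "j \<in> T" "lead s u (e j) (c j * d j)" using T(4) by blast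
  thus ?thesis using e dom[of "c j" "d j"] T(2,3) d by blast
qed

definition uniformizer :: "'f \<Rightarrow> bool" where
  "uniformizer s \<longleftrightarrow> s \<in> mm \<and> s \<noteq> 0 \<and> (\<forall>g. g \<noteq> 0 \<longrightarrow> (\<exists>j. \<exists>u\<in>units. g = s powi j * u))"

lemma place_ring_max_ideal: "place_ring mm = V"
proof -
  have "z \<in> place_ring mm \<longleftrightarrow> z \<in> V" for z
    using dichotomy[of z] V_zero by (cases "z = 0") (auto simp: place_ring_def max_ideal_def)
  thus ?thesis by blast
qed

text \<open>
  The exponent of a decomposition \<open>s\<^sup>i u\<close> is determined for any nonzero \<open>s\<close> in the maximal ideal,
  since otherwise a unit would be a positive power of \<open>s\<close> times a unit.
\<close>

lemma powi_unit_unique: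
  assumes s: "s \<in> mm" "s \<noteq> 0" and "s powi i * u = s powi j * v" "u \<in> units" "v \<in> units"
  shows "i = j"
proof -
  have False if "s powi i * u = s powi j * v" "u \<in> units" "v \<in> units" "i < j" for i j u v
  proof -
    have "u = s powi (j - i) * v" using that(1) s
      by (simp add: power_int_diff field_simps)
    hence "u \<in> mm" using s_powi_mm[OF s, of "j - i"] that mm_mult units_iff by auto
    thus False using that units_def by auto
  qed
  thus ?thesis using assms by (metis linorder_neqE)
qed

lemma prime_element_iff:
  assumes "prime_element mm s'"
  shows "s' \<in> mm" "\<And>z. z \<in> mm \<Longrightarrow> \<exists>r\<in>V. z = s' * r"
  using assms V_one unfolding prime_element_def place_ring_max_ideal by (auto intro: image_eqI[of _ _ 1])

lemma uniformizer_nonneg: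
  assumes "uniformizer s" "u \<in> units"
  shows "s powi j * u \<in> V \<longleftrightarrow> j \<ge> 0" "s powi j * u \<in> mm \<longleftrightarrow> j > 0"
proof -
  have s: "s \<in> mm" "s \<noteq> 0" using assms by (auto simp: uniformizer_def)
  have neg: "s powi j * u \<notin> V" if "j < 0"
  proof
    assume "s powi j * u \<in> V"
    hence "(s powi j * u) * s powi (- j) \<in> mm" using mm_mult2 s_powi_mm[OF s, of "-j"] that by auto
    moreover have "(s powi j * u) * s powi (- j) = u" using s by (simp add: power_int_minus field_simps)
    ultimately have "u \<in> mm" by (simp only:)
    thus False using assms units_def by auto
  qed
  have pos: "s powi j * u \<in> mm" if "j > 0"
    using mm_mult[OF s_powi_mm[OF s that]] assms units_iff by blast
  have "s powi j * u \<in> units" if "j = 0" using that assms by simp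
  thus "s powi j * u \<in> V \<longleftrightarrow> j \<ge> 0" "s powi j * u \<in> mm \<longleftrightarrow> j > 0"
    using neg pos mm_V unfolding units_def by (cases j "0::int" rule: linorder_cases; auto)+
qed

lemma prime_element_uniformizer:
  assumes "uniformizer s" shows "prime_element mm s"
proof -
  have s: "s \<in> mm" "s \<noteq> 0" using assms by (auto simp: uniformizer_def)
  have "z \<in> (\<lambda>r. s * r) ` V" if z: "z \<in> mm" for z
  proof (cases "z = 0")
    case True thus ?thesis using V_zero by (auto intro: image_eqI[of _ _ 0])
  next
    case False
    then obtain j u where ju: "u \<in> units" "z = s powi j * u"
      using assms by (auto simp: uniformizer_def)
    have "j > 0" using uniformizer_nonneg(2)[OF assms ju(1)] z ju by blast
    hence "s powi (j - 1) * u \<in> V" using uniformizer_nonneg(1)[OF assms ju(1)] by auto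
    moreover have "z = s * (s powi (j - 1) * u)" using ju s by (simp add: power_int_diff)
    ultimately show ?thesis by blast
  qed
  thus ?thesis using s mm_mult unfolding prime_element_def place_ring_max_ideal by blast
qed

text \<open>
  Two prime elements differ by a unit factor, so the value does not depend on the prime element
  that the definition of \<open>place_val\<close> picks.
\<close>

theorem place_val_uniformizer:
  assumes s: "uniformizer s" and u: "u \<in> units"
  shows "place_val mm (s powi j * u) = j"
proof -
  have s': "s \<in> mm" "s \<noteq> 0" using s by (auto simp: uniformizer_def)
  have eq: "n = j" if h: "prime_element mm r" "v \<in> units" "s powi j * u = r powi n * v" for r n v
  proof -
    obtain a where a: "a \<in> V" "s = r * a" using prime_element_iff[OF h(1)] s' by blast
    hence r0: "r \<noteq> 0" using s' by auto
    obtain b where b: "b \<in> V" "r = s * b"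
      using prime_element_iff(2)[OF prime_element_uniformizer[OF s]] prime_element_iff(1)[OF h(1)] by blast
    have "a * b = 1" using a b s' by (metis mult.assoc mult_cancel_left2 mult.commute)
    hence "b \<in> units" using a b by (metis inverse_unique mult.commute units_iff mult_zero_left zero_neq_one)
    hence "b powi n * v \<in> units" using units_mult units_powi h by blast
    moreover have "s powi j * u = s powi n * (b powi n * v)"
      using h b by (simp add: power_int_mult_distrib mult.assoc)
    ultimately show ?thesis using powi_unit_unique[OF s'] u by blast
  qed
  show ?thesis unfolding place_val_def place_ring_max_ideal
  proof (rule the_equality)
    show "\<exists>r v. prime_element mm r \<and> v \<in> V - mm \<and> s powi j * u = r powi j * v"
      using prime_element_uniformizer[OF s] u units_def by auto
  next
    fix n assume "\<exists>r v. prime_element mm r \<and> v \<in> V - mm \<and> s powi j * u = r powi n * v"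
    thus "n = j" using eq unfolding units_def by blast
  qed
qed

corollary place_val_nonneg_iff:
  assumes "uniformizer s" "g \<noteq> 0"
  shows "place_val mm g \<ge> 0 \<longleftrightarrow> g \<in> V"
proof -
  obtain j u where "u \<in> units" "g = s powi j * u" using assms by (auto simp: uniformizer_def)
  thus ?thesis using place_val_uniformizer uniformizer_nonneg(1) assms by metis
qed

corollary place_val_mult:
  assumes "uniformizer s" "g \<noteq> 0" "h \<noteq> 0"
  shows "place_val mm (g * h) = place_val mm g + place_val mm h"
proof -
  obtain i u where u: "u \<in> units" "g = s powi i * u" using assms by (auto simp: uniformizer_def)
  obtain j v where v: "v \<in> units" "h = s powi j * v" using assms by (auto simp: uniformizer_def)
  have "g * h = s powi (i + j) * (u * v)" using u v assms(1)
    by (simp add: power_int_add uniformizer_def)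
  thus ?thesis using u v place_val_uniformizer[OF assms(1)] units_mult by metis
qed

lemma powi_quotient:
  assumes s: "uniformizer s" and "g = s powi a * u" "f = s powi b * v" "u \<in> units" "v \<in> units"
  shows "place_val mm (g / f) = a - b" "g / f \<in> V \<longleftrightarrow> b \<le> a"
proof -
  have eq: "g / f = s powi (a - b) * (u / v)"
    using s assms(2,3) by (simp add: power_int_diff uniformizer_def)
  have uv: "u / v \<in> units" using assms units_divide by blast
  show "place_val mm (g / f) = a - b" unfolding eq by (rule place_val_uniformizer[OF s uv])
  show "g / f \<in> V \<longleftrightarrow> b \<le> a" unfolding eq uniformizer_nonneg(1)[OF s uv] by simp
qed

lemma lead_quotient:
  assumes s: "uniformizer s" and "lead s g a c" "lead s f b d" "c \<in> units" "d \<in> units"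
  shows "place_val mm (g / f) = a - b" "g / f \<in> V \<longleftrightarrow> b \<le> a"
proof -
  have s': "s \<in> mm" "s \<noteq> 0" using s by (auto simp: uniformizer_def)
  obtain u v where uv: "u \<in> units" "g = s powi a * u" "v \<in> units" "f = s powi b * v"
    using lead_unit[OF s'] assms by metis
  show "place_val mm (g / f) = a - b" "g / f \<in> V \<longleftrightarrow> b \<le> a"
    by (rule powi_quotient[OF s uv(2,4,1,3)])+
qed

end

lemma valuation_ring_valring: "valuation_ring K V \<Longrightarrow> is_valring V"
proof -
  assume "valuation_ring K V"
  hence V: "V \<noteq> {}" "\<forall>u\<in>V. \<forall>v\<in>V. u + v \<in> V \<and> u - v \<in> V \<and> u * v \<in> V"
    "\<forall>z. z \<noteq> 0 \<longrightarrow> z \<in> V \<or> inverse z \<in> V"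
    unfolding valuation_ring_def by (blast+)
  obtain v where "v \<in> V" using V(1) by blast
  hence "0 \<in> V" using V(2) by (metis diff_self)
  moreover have "1 \<in> V" using V(3)[rule_format, of 1] by simp
  moreover have "z \<in> V \<or> inverse z \<in> V" for z using V(3) \<open>0 \<in> V\<close> by (cases "z = 0") auto
  ultimately show ?thesis using V(2) unfolding is_valring_def is_subring_def by simp
qed

lemma is_place_iff: "is_place K P \<longleftrightarrow> (\<exists>V. valuation_ring K V \<and> P = max_ideal V)"
  by (simp add: is_place_def max_ideal_def)

lemma max_ideal_inject:
  assumes "is_valring V" "is_valring W" "max_ideal V = max_ideal W" shows "V = W"
proof -
  have "V = place_ring (max_ideal V)" "W = place_ring (max_ideal W)"
    using valring.place_ring_max_ideal[OF valring.intro] assms(1,2) by metis+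
  thus ?thesis using assms(3) by metis
qed

section \<open>Finite fields of characteristic three\<close>

lemma char3_add:
  fixes u v :: "'f::field"
  assumes "(3::'f) = 0"
  shows "(u + v) ^ 3 ^ n = u ^ 3 ^ n + v ^ 3 ^ n"
proof (induction n)
  case (Suc n)
  have "(a + b) ^ 3 = a ^ 3 + b ^ 3" for a b :: 'f
  proof -
    have "(a + b) ^ 3 = a ^ 3 + b ^ 3 + 3 * (a ^ 2 * b + a * b ^ 2)"
      by (simp add: power3_eq_cube power2_eq_square algebra_simps)
    thus ?thesis using assms by simp
  qed
  thus ?case using Suc by (simp add: power_mult power_mult[of _ _ 3] mult.commute[of 3])
qed simp

lemma char3_diff:
  fixes u v :: "'f::field"
  assumes "(3::'f) = 0"
  shows "(u - v) ^ 3 ^ n = u ^ 3 ^ n - v ^ 3 ^ n"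
  using char3_add[OF assms, of "u - v" v n] by (simp add: algebra_simps)

lemma char3_uminus: "(- u) ^ 3 ^ n = - (u ^ 3 ^ n :: 'f::field)"
  by (rule power_minus_odd) simp

lemma char3_sum:
  fixes g :: "'a \<Rightarrow> 'f::field"
  assumes "(3::'f) = 0"
  shows "(sum g S) ^ 3 ^ n = (\<Sum>i\<in>S. g i ^ 3 ^ n)"
  by (induction S rule: infinite_finite_induct) (auto simp: char3_add[OF assms])

lemma p_fun_diff:
  fixes u v :: "'f::field"
  assumes "(3::'f) = 0"
  shows "p_fun t (u - v) = p_fun t u - p_fun t v"
  by (simp add: p_fun_def char3_diff[OF assms] sum_subtractf)

text \<open>
  Cubing shifts the sum that defines \<open>p\<close> by one index, so the difference telescopes.
\<close>

lemma p_fun_cube: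
  fixes u :: "'f::field"
  assumes "(3::'f) = 0"
  shows "p_fun t u ^ 3 - p_fun t u = u ^ 3 ^ t - u"
proof -
  have "p_fun t u ^ 3 = (\<Sum>i<t. u ^ 3 ^ Suc i)"
    using char3_sum[OF assms, of "\<lambda>i. u ^ 3 ^ i" "{..<t}" 1]
    by (simp add: p_fun_def mult.commute flip: power_mult)
  thus ?thesis using sum_lessThan_telescope[of "\<lambda>i. u ^ 3 ^ i" t]
    unfolding p_fun_def by (simp add: sum_subtractf)
qed

text \<open>
  Translation by \<open>1\<close> permutes \<open>K\<close>, so adding \<open>1\<close> to all elements does not change their sum.
\<close>

lemma card_subfield_eq_0:
  fixes K :: "'f::field set"
  assumes "is_subfield K" "finite K"
  shows "of_nat (card K) = (0 :: 'f::field)"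
proof -
  have "(\<Sum>k\<in>K. k + 1) = \<Sum>K"
    by (rule sum.reindex_bij_witness[of _ "\<lambda>k. k - 1" "\<lambda>k. k + 1"])
      (use assms(1) in \<open>auto simp: is_subfield_def\<close>)
  thus ?thesis by (simp add: sum.distrib)
qed

text \<open>
  Multiplication by \<open>c \<noteq> 0\<close> permutes \<open>K - {0}\<close> and hence does not change the product of its
  elements.
\<close>

lemma subfield_power_card:
  assumes K: "is_subfield K" "finite K" and c: "c \<in> K"
  shows "c ^ card K = (c :: 'f::field)"
proof (cases "c = 0")
  case True
  have "card K > 0" using K c card_gt_0_iff by blast
  thus ?thesis using True by simp
next
  case False
  have mult: "u * v \<in> K" "inverse u \<in> K" if "u \<in> K" "v \<in> K" for u v
    using that K by (auto simp: is_subfield_def)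
  have "(\<Prod>k\<in>K - {0}. c * k) = \<Prod>(K - {0})"
    by (rule prod.reindex_bij_witness[of _ "\<lambda>k. inverse c * k" "\<lambda>k. c * k"])
      (use False mult c in \<open>auto simp: mult.assoc[symmetric]\<close>)
  hence "c ^ card (K - {0}) * \<Prod>(K - {0}) = \<Prod>(K - {0})" by (simp add: prod.distrib)
  moreover have "\<Prod>(K - {0}) \<noteq> 0" using K by simp
  ultimately have "c ^ card (K - {0}) = 1" by simp
  moreover have "0 \<in> K" using K by (simp add: is_subfield_def)
  hence "card K = Suc (card (K - {0}))" using K(2) by (metis card.remove)
  ultimately show ?thesis by simp
qed

lemma add_self_factor: "n > 0 \<Longrightarrow> w * (1 + w ^ (n - 1)) = w ^ n + (w :: 'f::field)"
  by (cases n) (simp_all add: algebra_simps)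

lemma add_self_factor_inverse:
  fixes w :: "'f::field"
  assumes "n > 0" "w \<noteq> 0"
  shows "w ^ n * (1 + inverse w ^ (n - 1)) = w ^ n + w"
  using assms by (cases n) (simp_all add: algebra_simps power_inverse)

lemma subfield_subring: "is_subfield K \<Longrightarrow> is_subring K"
  by (auto simp: is_subfield_def is_subring_def)

section \<open>The curve and its coordinate ring\<close>

text \<open>
  The curve together with the valuation ring \<open>V0\<close> of a place at the origin \<open>x = y = 0\<close>.
\<close>

locale z3 =
  fixes t :: nat and K :: "'f::field set" and x y :: 'f and V0 :: "'f set"
  assumes t: "t \<ge> 1" and K: "is_subfield K" and card_K: "card K = (3 ^ t)\<^sup>2"
    and adjoin: "adjoin K {x, y} = UNIV"
    and eqn: "x ^ 3 ^ t + x + (p_fun t y)\<^sup>2 = 0"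
    and V0: "valuation_ring K V0" and x0: "x \<in> max_ideal V0" and y0: "y \<in> max_ideal V0"
begin

definition q :: nat where "q = 3 ^ t"
definition Q :: nat where "Q = 3 ^ (t - 1)"
definition p :: 'f where "p = p_fun t y"
text \<open>
  On the Hermitian curve \<open>u\<^sup>q + u = -v\<^bsup>q+1\<^esup>\<close>, which covers the given curve by \<open>y = v\<^sup>3 - v\<close> and
  \<open>x = u - v\<^sup>2\<close>, this is the product of the equations of the tangent lines at the three points
  above the origin. Each tangent meets the Hermitian curve in its point of tangency only, which is why
  \<open>z\<close> vanishes nowhere but at the origin.
\<close>

definition z :: 'f where "z = x ^ 3 - x ^ 2 + x + y ^ 2"
definition R :: "'f set" where "R = ring_adjoin (ring_adjoin K y) x"

lemma q_Q: "q = 3 * Q" "Q \<ge> 1" "q \<ge> 3"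
proof -
  show "q = 3 * Q" "Q \<ge> 1"
    unfolding q_def Q_def using t by (auto simp flip: power_Suc)
  thus "q \<ge> 3" by simp
qed

lemma odd_q: "odd q" by (simp add: q_def)

lemma finite_K: "finite K" using card_K by (metis card.infinite power_not_zero zero_neq_numeral)

lemma K_subring: "is_subring K" by (rule subfield_subring[OF K])

lemma K_inverse: "c \<in> K \<Longrightarrow> inverse c \<in> K" using K by (simp add: is_subfield_def)

lemma K_nonzero_mult: "c \<in> K - {0} \<Longrightarrow> d \<in> K - {0} \<Longrightarrow> c * d \<in> K - {0}"
  using is_subringD(5)[OF K_subring] by auto

lemma minus_one_K: "(- 1) ^ n \<in> K - {0}"
  using is_subringD[OF K_subring] by auto

lemma three: "(3::'f) = 0"
proof -
  have "of_nat (card K) = (0::'f)" by (rule card_subfield_eq_0[OF K finite_K])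
  thus ?thesis by (simp add: card_K)
qed

lemma K_power: "c \<in> K \<Longrightarrow> c ^ card K = c"
  by (rule subfield_power_card[OF K finite_K])

lemma xq: "x ^ q = - x - p ^ 2"
  using eqn by (simp add: q_def p_def eq_neg_iff_add_eq_0 algebra_simps)

lemma yq: "y ^ q = y + p ^ 3 - p"
  using p_fun_cube[OF three, of t y] by (simp add: q_def p_def algebra_simps)

text \<open>
  Expressing \<open>x\<^sup>q\<close> by \<open>x\<close> and \<open>p\<close>, and \<open>y\<^sup>q\<close> by \<open>y\<close> and \<open>p\<close>, turns the left-hand side into a polynomial in
  \<open>x\<close>, \<open>y\<close>, \<open>p\<close> all of whose coefficients are multiples of three.
\<close>

theorem hermitian: "z ^ q + z + x ^ (q + 1) + y ^ (q + 1) = 0"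
proof -
  have "z ^ q = (x ^ q) ^ 3 - (x ^ q) ^ 2 + x ^ q + (y ^ q) ^ 2"
    by (simp add: z_def q_def char3_add[OF three] char3_diff[OF three] mult.commute flip: power_mult)
  hence "z ^ q + z + x ^ (q + 1) + y ^ (q + 1)
     = (- x - p ^ 2) ^ 3 - (- x - p ^ 2) ^ 2 + (- x - p ^ 2) + (y + p ^ 3 - p) ^ 2
       + z + (- x - p ^ 2) * x + (y + p ^ 3 - p) * y"
    by (simp add: xq yq)
  also have "\<dots> = 3 * (y ^ 2 - x ^ 2 - x ^ 2 * p ^ 2 - x * p ^ 4 - x * p ^ 2 - p ^ 4 + y * p ^ 3 - y * p)"
    unfolding z_def by algebra
  also have "\<dots> = 0" using three by simp
  finally show ?thesis .
qed

lemma Ky_subring: "is_subring (ring_adjoin K y)" by (rule ring_adjoin_subring[OF K_subring])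

lemma R_subring: "is_subring R" unfolding R_def by (rule ring_adjoin_subring[OF Ky_subring])

lemmas R_one = is_subringD(1)[OF R_subring]
  and R_zero = is_subringD(2)[OF R_subring]
  and R_add = is_subringD(3)[OF R_subring]
  and R_diff = is_subringD(4)[OF R_subring]
  and R_mult = is_subringD(5)[OF R_subring]
  and R_power = is_subringD(7)[OF R_subring]

lemma K_R: "K \<subseteq> R" and x_R: "x \<in> R" and y_R: "y \<in> R"
  using ring_adjoin_base[OF Ky_subring, of x] ring_adjoin_base[OF K_subring, of y] unfolding R_def by auto

lemma z_R: "z \<in> R" unfolding z_def by (intro R_add R_diff R_power x_R y_R)

lemma R_least: "is_subring S \<Longrightarrow> K \<subseteq> S \<Longrightarrow> x \<in> S \<Longrightarrow> y \<in> S \<Longrightarrow> R \<subseteq> S"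
  unfolding R_def by (intro ring_adjoin_least)

lemma fraction:
  obtains A B where "A \<in> R" "B \<in> R" "B \<noteq> 0" "f = A / B"
proof -
  define L where "L = {A / B | A B. A \<in> R \<and> B \<in> R \<and> B \<noteq> 0}"
  have RL: "A \<in> L" if "A \<in> R" for A
    unfolding L_def mem_Collect_eq using that R_one by (intro exI[of _ A] exI[of _ 1]) simp
  have L: "u + v \<in> L \<and> u - v \<in> L \<and> u * v \<in> L" if uv: "u \<in> L" "v \<in> L" for u v
  proof -
    obtain A B C D where AB: "A \<in> R" "B \<in> R" "B \<noteq> 0" "u = A / B" "C \<in> R" "D \<in> R" "D \<noteq> 0" "v = C / D"
      using uv unfolding L_def by blast
    have "u + v = (A * D + C * B) / (B * D)" "u - v = (A * D - C * B) / (B * D)"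
      "u * v = (A * C) / (B * D)"
      using AB by (auto simp: add_frac_eq diff_frac_eq)
    moreover have "A * D + C * B \<in> R" "A * D - C * B \<in> R" "A * C \<in> R" "B * D \<in> R" "B * D \<noteq> 0"
      using AB by (auto intro: R_add R_diff R_mult)
    ultimately show ?thesis unfolding L_def by blast
  qed
  have inv: "inverse u \<in> L" if uL: "u \<in> L" for u
  proof (cases "u = 0")
    case False
    obtain A B where AB: "A \<in> R" "B \<in> R" "B \<noteq> 0" "u = A / B" using uL unfolding L_def by blast
    hence "inverse u = B / A" "A \<noteq> 0" using False by auto
    thus ?thesis unfolding L_def using AB by blast
  qed (use RL R_zero in simp)
  have "is_subfield L" unfolding is_subfield_def using L inv RL R_zero R_one by blast
  moreover have "K \<union> {x, y} \<subseteq> L" using K_R x_R y_R RL by auto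
  ultimately have "adjoin K {x, y} \<subseteq> L" unfolding adjoin_def by (rule hull_minimal[rotated])
  hence "f \<in> L" using adjoin by blast
  thus ?thesis using that unfolding L_def by blast
qed

text \<open>
  A valuation ring over \<open>K\<close>, the whole field included; this is what Chevalley's theorem delivers
  directly.
\<close>

definition place_over :: "'f set \<Rightarrow> bool" where
  "place_over V \<longleftrightarrow> is_valring V \<and> K \<subseteq> V"

lemma K_units: "place_over V \<Longrightarrow> K - {0} \<subseteq> valring.units V"
  using valring.units_iff[OF valring.intro, of V] K_inverse unfolding place_over_def by auto

lemma V0_place: "place_over V0" 
  using V0 valuation_ring_valring[OF V0] by (auto simp: place_over_def valuation_ring_def)

text \<open>
  If \<open>y = 0\<close> then \<open>x\<close> is a root of \<open>X\<^sup>q + X\<close> in the maximal ideal, hence zero, and the function field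
  would collapse to \<open>K\<close>.
\<close>

lemma y_nonzero: "y \<noteq> 0"
proof
  assume y: "y = 0"
  interpret V: valring V0 using V0_place by unfold_locales (simp add: place_over_def)
  have "x ^ 3 ^ t + x = 0" using eqn y by (simp add: p_fun_def zero_power)
  hence "x * (1 + x ^ (3 ^ t - 1)) = 0" by (subst add_self_factor) simp_all
  moreover have "1 + x ^ (3 ^ t - 1) \<in> V.units"
    using q_Q(3) unfolding q_def by (intro V.units_add_mm V.one_unit V.mm_power x0) simp
  ultimately have "x = 0" using V.units_iff by simp
  hence "adjoin K {x, y} \<subseteq> K" unfolding adjoin_def
    by (intro hull_minimal) (use y K in \<open>auto simp: is_subfield_def\<close>)
  thus False using adjoin V0 unfolding valuation_ring_def by blast
qed

lemma y_powers_distinct: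
  assumes "y ^ i = y ^ j" shows "i = j"
proof -
  interpret V: valring V0 using V0_place by unfold_locales (simp add: place_over_def)
  have "y powi int i * 1 = y powi int j * 1" using assms by simp
  hence "int i = int j" by (rule V.powi_unit_unique[OF y0 y_nonzero _ V.one_unit V.one_unit])
  thus ?thesis by simp
qed

text \<open>
  In \<open>K[1/y]\<close> the element \<open>1/y\<close> generates a proper ideal: since \<open>y\<close> vanishes at the origin, a
  polynomial in \<open>1/y\<close> is constant or has a pole there, so it cannot equal \<open>y\<close>.
  Chevalley's theorem then gives a valuation ring in which \<open>1/y\<close> is not invertible.
\<close>

lemma exists_infinite_place: "\<exists>V. place_over V \<and> y \<notin> V"
proof -
  interpret V: valring V0 using V0_place by unfold_locales (simp add: place_over_def)
  let ?w = "inverse y"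
  let ?A = "ring_adjoin K ?w"
  have A: "is_subring ?A" by (rule ring_adjoin_subring[OF K_subring])
  have yV: "y \<in> V0" using y0 V.mm_V by blast
  have KV: "K \<subseteq> V0" using V0_place by (simp add: place_over_def)
  have D: "poly f ?w \<in> K \<or> poly f ?w \<notin> V0" if "\<forall>i. coeff f i \<in> K" for f
    using that
  proof (induction f)
    case 0 thus ?case using is_subringD(2)[OF K_subring] by simp
  next
    case (pCons a f)
    have a: "a \<in> K" using pCons(3) by (metis coeff_pCons_0)
    have "\<forall>i. coeff f i \<in> K" using pCons(3) by (metis coeff_pCons_Suc)
    hence IH: "poly f ?w \<in> K \<or> poly f ?w \<notin> V0" using pCons(2) by blast
    show ?case
    proof (cases "poly f ?w = 0")
      case True thus ?thesis using a by simp
    next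
      case False
      have "?w * poly f ?w \<notin> V0"
      proof
        assume w: "?w * poly f ?w \<in> V0"
        have e: "poly f ?w = y * (?w * poly f ?w)" using y_nonzero by simp
        hence m: "poly f ?w \<in> V.mm" using V.mm_mult[OF y0 w] by metis
        hence "poly f ?w \<in> K - {0}" using IH False V.mm_V by blast
        thus False using m K_units[OF V0_place] unfolding V.units_def by blast
      qed
      hence "a + ?w * poly f ?w \<notin> V0" using V.V_diff[of "a + ?w * poly f ?w" a] a KV by auto
      thus ?thesis by simp
    qed
  qed
  have gen: "\<exists>a\<in>?A. u = ?w * a" if "u \<in> lincombs {?w} ?A" for u
    using that
  proof induction
    case zero show ?case using is_subringD(2)[OF A] by (intro bexI[of _ 0]) auto
  next
    case (step i b u)
    then obtain a where "a \<in> ?A" "u = ?w * a" by blast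
    thus ?case using step is_subringD(3)[OF A, of b a] by (intro bexI[of _ "b + a"]) (auto simp: algebra_simps)
  qed
  have "1 \<notin> lincombs {?w} ?A"
  proof
    assume "1 \<in> lincombs {?w} ?A"
    then obtain a where a: "a \<in> ?A" "1 = ?w * a" using gen by blast
    hence "a = y" using y_nonzero by (simp add: field_simps)
    then obtain f where "\<forall>i. coeff f i \<in> K" "y = poly f ?w"
      using a(1) unfolding ring_adjoin_def by blast
    hence "y \<in> K \<or> y \<notin> V0" using D[of f] by simp
    hence "y \<in> K - {0}" using yV y_nonzero by blast
    thus False using y0 K_units[OF V0_place] unfolding V.units_def by blast
  qed
  then obtain V where V: "is_valring V" "?A \<subseteq> V" "{?w} \<subseteq> max_ideal V"
    using exists_dominating_valring[OF A, of "{?w}"] ring_adjoin_base(2)[OF K_subring] by blast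
  have "K \<subseteq> V" using ring_adjoin_base(1)[OF K_subring] V(2) by blast
  moreover have "y \<notin> V" using V(3) y_nonzero by (auto simp: max_ideal_def)
  ultimately show ?thesis using V(1) unfolding place_over_def by blast
qed

definition mon :: "nat \<Rightarrow> nat \<Rightarrow> nat \<Rightarrow> 'f" where
  "mon i j k = x ^ i * y ^ j * z ^ k"

text \<open>
  The pole order of \<open>x\<^sup>i y\<^sup>j z\<^sup>k\<close> at infinity.
\<close>

definition wt :: "nat \<Rightarrow> nat \<Rightarrow> nat \<Rightarrow> nat" where
  "wt i j k = Q * (2 * i + 3 * j) + (q + 1) * k"

lemma mon_R: "mon i j k \<in> R"
  unfolding mon_def by (intro R_mult R_power x_R y_R z_R)

lemma y_square: "y ^ 2 = z - x ^ 3 + x ^ 2 - x" by (simp add: z_def)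

definition xz_span :: "nat \<Rightarrow> 'f set" where
  "xz_span n = lincombs {x ^ i * z ^ k | i k. k \<le> n} K"

lemma xz_span_base: "k \<le> n \<Longrightarrow> x ^ i * z ^ k \<in> xz_span n"
  unfolding xz_span_def by (intro lincombs_base[OF K_subring]) blast

lemma xz_span_add: "u \<in> xz_span n \<Longrightarrow> v \<in> xz_span n \<Longrightarrow> u + v \<in> xz_span n"
  unfolding xz_span_def by (rule lincombs_add)

lemma xz_span_diff: "u \<in> xz_span n \<Longrightarrow> v \<in> xz_span n \<Longrightarrow> u - v \<in> xz_span n"
  unfolding xz_span_def by (rule lincombs_diff[OF K_subring])

lemma xz_span_mono: "m \<le> n \<Longrightarrow> xz_span m \<subseteq> xz_span n"
  unfolding xz_span_def by (intro lincombs_mono) (blast intro: le_trans)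

lemma xz_span_x: "u \<in> xz_span n \<Longrightarrow> u * x ^ m \<in> xz_span n"
proof -
  have "b * x ^ m \<in> lincombs {x ^ i * z ^ k | i k. k \<le> n} K"
    if b: "b \<in> {x ^ i * z ^ k | i k. k \<le> n}" for b
  proof -
    obtain i k where "k \<le> n" "b = x ^ i * z ^ k" using b by blast
    hence "b * x ^ m = x ^ (i + m) * z ^ k" by (simp add: power_add)
    thus ?thesis using xz_span_base[of k n "i + m"] \<open>k \<le> n\<close> by (simp add: xz_span_def)
  qed
  thus "u \<in> xz_span n \<Longrightarrow> u * x ^ m \<in> xz_span n"
    unfolding xz_span_def by (rule lincombs_map[OF K_subring])
qed

lemma xz_span_z: "u \<in> xz_span n \<Longrightarrow> u * z \<in> xz_span (Suc n)"
proof -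
  have "b * z \<in> lincombs {x ^ i * z ^ k | i k. k \<le> Suc n} K"
    if b: "b \<in> {x ^ i * z ^ k | i k. k \<le> n}" for b
  proof -
    obtain i k where "k \<le> n" "b = x ^ i * z ^ k" using b by blast
    hence e: "b * z = x ^ i * z ^ Suc k" by simp
    show ?thesis unfolding e using xz_span_base[of "Suc k" "Suc n" i] \<open>k \<le> n\<close>
      by (simp add: xz_span_def)
  qed
  thus "u \<in> xz_span n \<Longrightarrow> u * z \<in> xz_span (Suc n)"
    unfolding xz_span_def by (rule lincombs_map[OF K_subring])
qed

text \<open>
  The relation \<open>y\<^sup>2 = z - x\<^sup>3 + x\<^sup>2 - x\<close> trades two factors \<open>y\<close> for one factor \<open>z\<close> and polynomials
  in \<open>x\<close>.
\<close>

lemma even_power_y: "y ^ (2 * n) \<in> xz_span n"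
proof (induction n)
  case 0
  show ?case using xz_span_base[of 0 0 0] by simp
next
  case (Suc n)
  have m: "u \<in> xz_span n \<Longrightarrow> u \<in> xz_span (Suc n)" for u using xz_span_mono[of n "Suc n"] by auto
  have "y ^ (2 * Suc n) = y ^ (2 * n) * z - y ^ (2 * n) * x ^ 3 + y ^ (2 * n) * x ^ 2 - y ^ (2 * n) * x ^ 1"
  proof -
    have "y ^ (2 * Suc n) = y ^ (2 * n) * y ^ 2" by (simp add: power2_eq_square mult_ac)
    also have "\<dots> = y ^ (2 * n) * (z - x ^ 3 + x ^ 2 - x)" by (simp only: y_square)
    finally show ?thesis by (simp add: algebra_simps)
  qed
  also have "\<dots> \<in> xz_span (Suc n)"
    by (intro xz_span_add xz_span_diff xz_span_z m xz_span_x Suc)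
  finally show ?case .
qed

lemma p_split: "p = (\<Sum>i<t - 1. y ^ 3 ^ i) + y ^ Q"
proof -
  have "{..<t} = insert (t - 1) {..<t - 1}" using t by auto
  thus ?thesis by (simp add: p_def p_fun_def Q_def)
qed

text \<open>
  Raising the definition of \<open>z\<close> to the power \<open>Q\<close> gives
  \<open>z\<^sup>Q = -x - (p\<^sup>2 - y\<^bsup>2Q\<^esup>) - x\<^bsup>2Q\<^esup> + x\<^sup>Q\<close>. The bracket only contains even powers \<open>y\<^bsup>2n\<^esup>\<close> with \<open>n < Q\<close>,
  because the top power of \<open>y\<close> in \<open>p\<^sup>2\<close> cancels.
\<close>

lemma z_power_Q: "z ^ Q \<in> xz_span (Q - 1)"
proof -
  let ?G = "xz_span (Q - 1)"
  have ev: "y ^ (3 ^ i + 3 ^ j) \<in> ?G" if "i < t - 1" "j \<le> t - 1" for i j :: nat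
  proof -
    have lt: "(3::nat) ^ i < Q" "(3::nat) ^ j \<le> Q" using that by (auto simp: Q_def)
    have "even ((3::nat) ^ i + 3 ^ j)" by simp
    then obtain n where n: "(3::nat) ^ i + 3 ^ j = 2 * n" by blast
    hence "n \<le> Q - 1" using lt by linarith
    thus ?thesis using even_power_y[of n] xz_span_mono[of n "Q - 1"] n by auto
  qed
  have sum: "sum g S \<in> ?G" if "\<And>i. i \<in> S \<Longrightarrow> g i \<in> ?G" for g and S :: "nat set"
    using that unfolding xz_span_def by (rule lincombs_sum)
  define p' where "p' = (\<Sum>i<t - 1. y ^ 3 ^ i)"
  have "p' * p' = (\<Sum>i<t - 1. \<Sum>j<t - 1. y ^ (3 ^ i + 3 ^ j))"
    by (simp add: p'_def sum_product power_add)
  also have "\<dots> \<in> ?G" by (intro sum ev) auto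
  finally have 1: "p' * p' \<in> ?G" .
  have "p' * y ^ Q = (\<Sum>i<t - 1. y ^ (3 ^ i + 3 ^ (t - 1)))"
    by (simp add: p'_def sum_distrib_right power_add Q_def)
  also have "\<dots> \<in> ?G" by (intro sum ev) auto
  finally have 2: "p' * y ^ Q \<in> ?G" .
  have xs: "x ^ m \<in> ?G" for m using xz_span_base[of 0 "Q - 1" m] by simp
  have "z ^ Q = (x ^ Q) ^ 3 - (x ^ Q) ^ 2 + x ^ Q + (y ^ Q) ^ 2"
    unfolding z_def Q_def by (simp add: char3_add[OF three] char3_diff[OF three] mult.commute flip: power_mult)
  also have "(x ^ Q) ^ 3 = - x - (p' + y ^ Q) ^ 2"
    using xq p_split by (simp add: q_Q(1) p'_def power_mult mult.commute flip: power_mult)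
  also have "- x - (p' + y ^ Q) ^ 2 - (x ^ Q) ^ 2 + x ^ Q + (y ^ Q) ^ 2
     = x ^ Q - x ^ 1 - x ^ (Q * 2) - p' * p' - (p' * y ^ Q + p' * y ^ Q)"
    by (simp add: power2_eq_square power_mult algebra_simps)
  also have "\<dots> \<in> ?G" by (intro xz_span_add xz_span_diff xs 1 2)
  finally show ?thesis .
qed

text \<open>
  Powers of \<open>y\<close> beyond the first are removed by \<open>y\<^sup>2 = z - x\<^sup>3 + x\<^sup>2 - x\<close>, and powers of \<open>z\<close> from the
  \<open>Q\<close>-th on by \<open>z_power_Q\<close>.
\<close>

lemma R_span: "R \<subseteq> lincombs {mon i j k | i j k. j < 2 \<and> k < Q} K"
proof -
  let ?B = "{mon i j k | i j k. j < 2 \<and> k < Q}"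
  let ?L = "lincombs ?B K"
  let ?G = "xz_span (Q - 1)"
  have base: "mon i j k \<in> ?L" if "j < 2" "k < Q" for i j k
    using that by (intro lincombs_base[OF K_subring]) blast
  have GL: "?G \<subseteq> ?L" unfolding xz_span_def
  proof (rule lincombs_mono, safe)
    fix i k assume "k \<le> Q - 1"
    thus "\<exists>i' j k'. x ^ i * z ^ k = mon i' j k' \<and> j < 2 \<and> k' < Q"
      using q_Q(2) by (intro exI[of _ i] exI[of _ 0] exI[of _ k]) (auto simp: mon_def)
  qed
  have Gz: "u * z \<in> ?G" if "u \<in> ?G" for u
  proof -
    have "b * z \<in> lincombs {x ^ i * z ^ k | i k. k \<le> Q - 1} K"
      if b: "b \<in> {x ^ i * z ^ k | i k. k \<le> Q - 1}" for b
    proof -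
      obtain i k where ik: "k \<le> Q - 1" "b = x ^ i * z ^ k" using b by blast
      have "b * z \<in> ?G"
      proof (cases "Suc k \<le> Q - 1")
        case True thus ?thesis using xz_span_base[OF True, of i] ik by (simp add: mult.commute mult.left_commute)
      next
        case False
        hence "Suc k = Q" using ik q_Q(2) by linarith
        hence "b * z = z ^ Q * x ^ i" using ik by (auto simp flip: \<open>Suc k = Q\<close>)
        thus ?thesis using xz_span_x[OF z_power_Q] by simp
      qed
      thus ?thesis by (simp add: xz_span_def)
    qed
    thus ?thesis using that unfolding xz_span_def by (rule lincombs_map[OF K_subring])
  qed
  have Lx: "u * x \<in> ?L" if "u \<in> ?L" for u
  proof (rule lincombs_map[OF K_subring _ that])
    fix b assume "b \<in> ?B"
    then obtain i j k where "b = mon i j k" "j < 2" "k < Q" by blast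
    thus "b * x \<in> ?L" using base[of j k "Suc i"] by (simp add: mon_def algebra_simps)
  qed
  have Ly: "u * y \<in> ?L" if "u \<in> ?L" for u
  proof (rule lincombs_map[OF K_subring _ that])
    fix b assume "b \<in> ?B"
    then obtain i j k where b: "b = mon i j k" "j < 2" "k < Q" by blast
    show "b * y \<in> ?L"
    proof (cases "j = 0")
      case True
      thus ?thesis using b base[of 1 k i] by (simp add: mon_def algebra_simps)
    next
      case False
      define g where "g = x ^ i * z ^ k"
      have g: "g \<in> ?G" unfolding g_def using b by (intro xz_span_base) simp
      have "b * y = g * y ^ 2" using b False by (simp add: g_def mon_def less_2_cases_iff power2_eq_square)
      also have "\<dots> = g * z - g * x ^ 3 + g * x ^ 2 - g * x ^ 1"
        by (simp only: y_square) (simp add: algebra_simps)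
      also have "\<dots> \<in> ?G" by (intro xz_span_add xz_span_diff xz_span_x Gz g)
      finally show ?thesis using GL by blast
    qed
  qed
  \<comment> \<open>The multipliers of the span form a ring containing \<open>K\<close>, \<open>x\<close> and \<open>y\<close>.\<close>
  define S where "S = {u. \<forall>v\<in>?L. v * u \<in> ?L}"
  have "is_subring S" unfolding is_subring_def S_def
    using lincombs_add[of _ ?B K] lincombs_diff[OF K_subring, of _ ?B]
    by (auto simp: distrib_left right_diff_distrib simp flip: mult.assoc)
  moreover have "K \<subseteq> S"
  proof
    fix c assume "c \<in> K"
    hence "c * v \<in> ?L" if "v \<in> ?L" for v using lincombs_mult[OF K_subring that] by blast
    thus "c \<in> S" unfolding S_def by (simp add: mult.commute[of _ c])
  qed
  moreover have "x \<in> S" "y \<in> S" using Lx Ly by (auto simp: S_def)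
  ultimately have "R \<subseteq> S" by (rule R_least)
  moreover have "1 \<in> ?L" using base[of 0 0 0] q_Q(2) by (simp add: mon_def)
  ultimately show ?thesis unfolding S_def by fastforce
qed

text \<open>
  The weight is congruent to \<open>k\<close> modulo \<open>Q\<close>, and the parity of \<open>2i + 3j\<close> is that of \<open>j\<close>.
\<close>

lemma wt_inject:
  assumes "wt i j k = wt i' j' k'" "j < 2" "j' < 2" "k < Q" "k' < Q"
  shows "i = i' \<and> j = j' \<and> k = k'"
proof -
  have w: "wt i j k = Q * (2 * i + 3 * j + 3 * k) + k" for i j k
    by (simp add: wt_def q_Q(1) algebra_simps)
  have "k = wt i j k mod Q" "k' = wt i' j' k' mod Q" unfolding w using assms by auto
  hence k: "k = k'" using assms(1) by simp
  have "Q * (2 * i + 3 * j) = Q * (2 * i' + 3 * j')" using assms(1) k by (simp add: wt_def)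
  hence "2 * i + 3 * j = 2 * i' + 3 * j'" using q_Q(2) by simp
  thus ?thesis using k assms(2,3) by presburger
qed

text \<open>
  The monomials \<open>x\<^bsup>(q+1)/2\<^esup>\<close> and \<open>z\<^sup>Q\<close> have the same pole order at infinity.
\<close>

definition half :: nat where "half = (q + 1) div 2"

lemma two_half: "2 * half = q + 1" using odd_q unfolding half_def by simp

end

section \<open>Places at infinity\<close>

locale z3_infinite = z3 t K x y V0 for t K and x y :: "'f::field" and V0 +
  fixes V :: "'f set"
  assumes V: "place_over V" and y_V: "y \<notin> V"
begin

sublocale valring V using V by unfold_locales (simp add: place_over_def)

lemma K_V: "K \<subseteq> V" using V by (simp add: place_over_def)

lemma K_unit: "c \<in> K - {0} \<Longrightarrow> c \<in> units" using K_units[OF V] by blast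

lemma inverse_y: "inverse y \<in> mm" using inverse_mm y_V by blast

text \<open>
  At a pole of \<open>y\<close> the top power dominates.
\<close>

lemma p_over_y: "p / y ^ Q - 1 \<in> mm"
proof -
  have "p / y ^ Q - 1 = (\<Sum>i<t - 1. y ^ 3 ^ i / y ^ Q)"
    unfolding p_split using y_nonzero by (simp add: add_divide_distrib sum_divide_distrib)
  also have "\<dots> \<in> mm"
  proof (rule mm_sum)
    fix i assume i: "i \<in> {..<t - 1}"
    hence lt: "(3::nat) ^ i < Q" by (auto simp: Q_def)
    have "y ^ 3 ^ i / y ^ Q = inverse y ^ (Q - 3 ^ i)"
      using lt y_nonzero by (simp add: power_inverse power_diff field_simps)
    thus "y ^ 3 ^ i / y ^ Q \<in> mm" using mm_power[OF inverse_y, of "Q - 3 ^ i"] lt by simp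
  qed
  finally show ?thesis .
qed

lemma p_unit: "p / y ^ Q \<in> units"
  using units_add_mm[OF one_unit p_over_y] by simp

lemma x_notin_V: "x \<notin> V"
proof
  assume x: "x \<in> V"
  have "p ^ 2 = - x - x ^ q" using xq by (simp add: algebra_simps)
  hence "p ^ 2 \<in> V" using x by (simp add: V_diff V_minus V_power)
  moreover have "p \<notin> V"
    using not_V_mult_unit[OF not_V_power[OF y_V, of Q] p_unit] q_Q(2) y_nonzero by simp
  ultimately show False using not_V_power[of p 2] by simp
qed

lemma x_nonzero: "x \<noteq> 0" using x_notin_V V_zero by auto

text \<open>
  The dominant terms of \<open>x\<^sup>q + x = -p\<^sup>2\<close> are \<open>x\<^sup>q\<close> and \<open>y\<^bsup>2Q\<^esup>\<close>, which gives the congruence for the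
  \<open>Q\<close>-th power of \<open>x\<^sup>3/y\<^sup>2\<close>; in characteristic three it passes to \<open>x\<^sup>3/y\<^sup>2\<close> itself.
\<close>

lemma x_cube: "x ^ 3 / y ^ 2 + 1 \<in> mm"
proof -
  define P where "P = p / y ^ Q"
  define b where "b = inverse x ^ (q - 1)"
  have b: "b \<in> mm" unfolding b_def using q_Q(3) by (intro mm_power inverse_mm x_notin_V) simp
  have P: "(P - 1) * (P + 1) \<in> mm"
  proof -
    have "P \<in> V" using p_unit units_iff unfolding P_def by blast
    thus ?thesis using p_over_y V_add V_one unfolding P_def by (intro mm_mult) auto
  qed
  have "x ^ q * (1 + b) = x ^ q + x"
    unfolding b_def using q_Q(3) x_nonzero by (intro add_self_factor_inverse) simp_all
  also have "\<dots> = - (p ^ 2)" using xq by simp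
  also have "p ^ 2 = (y ^ Q) ^ 2 * (1 + (P - 1) * (P + 1))"
    using y_nonzero unfolding P_def by (simp add: field_simps power2_eq_square)
  finally have "x ^ q / (y ^ Q) ^ 2 + 1 \<in> mm"
    using unit_quotient[OF P b] y_nonzero by simp
  moreover have "(x ^ 3 / y ^ 2 + 1) ^ Q = x ^ q / (y ^ Q) ^ 2 + 1"
    unfolding Q_def char3_add[OF three]
    by (simp add: power_divide q_Q(1) Q_def mult.commute flip: power_mult)
  ultimately show ?thesis using mm_root by metis
qed

lemma x_cube_unit: "x ^ 3 / y ^ 2 \<in> units"
  using units_add_mm[OF units_minus[OF one_unit] x_cube] by simp

lemma x_over_y: "x / y \<in> mm"
proof -
  have "(x / y) ^ 3 = (x ^ 3 / y ^ 2) * inverse y"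
    by (simp add: power_divide power3_eq_cube power2_eq_square divide_inverse mult.assoc)
  also have "\<dots> \<in> mm" using x_cube_unit inverse_y mm_mult2 units_iff by blast
  finally show ?thesis by (rule mm_root)
qed

text \<open>
  Since \<open>y\<close> and \<open>z\<close> turn out to have pole orders \<open>q\<close> and \<open>q + 1\<close>, their quotient has order one.
\<close>

definition \<tau> where "\<tau> = y / z"

lemma z_notin_V: "z \<notin> V"
proof
  assume "z \<in> V"
  hence "z ^ q + z \<in> V" using V_add V_power by blast
  moreover have "z ^ q + z = - (y ^ (q + 1) * (1 + (x / y) ^ (q + 1)))"
    using hermitian y_nonzero by (simp add: power_divide algebra_simps eq_neg_iff_add_eq_0 del: power_Suc)
  moreover have "y ^ (q + 1) * (1 + (x / y) ^ (q + 1)) \<notin> V"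
    by (intro not_V_mult_unit not_V_power y_V units_add_mm one_unit mm_power x_over_y) auto
  ultimately show False using V_minus by fastforce
qed

lemma z_nonzero: "z \<noteq> 0" using z_notin_V V_zero by auto

text \<open>
  The dominant terms of the equation \<open>hermitian\<close> are \<open>z\<^sup>q\<close> and \<open>y\<^bsup>q+1\<^esup>\<close>.
\<close>

lemma y_tau: "y * \<tau> ^ q + 1 \<in> mm"
proof -
  define a where "a = (x / y) ^ (q + 1)"
  define b where "b = inverse z ^ (q - 1)"
  have a: "a \<in> mm" unfolding a_def by (intro mm_power x_over_y) simp
  have b: "b \<in> mm" unfolding b_def using q_Q(3) by (intro mm_power inverse_mm z_notin_V) simp
  have "z ^ q * (1 + b) = z ^ q + z"
    unfolding b_def using q_Q(3) z_nonzero by (intro add_self_factor_inverse) simp_all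
  also have "\<dots> = - (y ^ (q + 1) * (1 + a))"
    using hermitian y_nonzero unfolding a_def
    by (simp add: power_divide algebra_simps eq_neg_iff_add_eq_0 del: power_Suc)
  finally have "y ^ (q + 1) * (1 + a) = - (z ^ q * (1 + b))" by simp
  hence "y ^ (q + 1) / z ^ q + 1 \<in> mm" using unit_quotient[OF b a] z_nonzero by simp
  also have "y ^ (q + 1) / z ^ q = y * \<tau> ^ q" unfolding \<tau>_def by (simp add: power_divide)
  finally show ?thesis .
qed

lemma y_tau_unit: "y * \<tau> ^ q \<in> units"
  using units_add_mm[OF units_minus[OF one_unit] y_tau] by simp

lemma \<tau>: "\<tau> \<in> mm" "\<tau> \<noteq> 0"
proof -
  show "\<tau> \<noteq> 0" using y_nonzero z_nonzero by (simp add: \<tau>_def)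
  have "\<tau> ^ q = (y * \<tau> ^ q) * inverse y" using y_nonzero by simp
  also have "\<dots> \<in> mm" using mm_mult2 y_tau_unit inverse_y units_iff by blast
  finally show "\<tau> \<in> mm" by (rule mm_root)
qed

lemma lead_y: "lead \<tau> y (- int q) (- 1)"
  using y_tau by (simp add: lead_def)

lemma lead_z: "lead \<tau> z (- int (q + 1)) (- 1)"
proof -
  have "z * \<tau> powi int (q + 1) = y * \<tau> ^ q"
    using z_nonzero unfolding power_int_of_nat by (simp add: \<tau>_def)
  thus ?thesis using y_tau unfolding lead_def by (simp add: add.commute)
qed

text \<open>
  The cube of \<open>x \<tau>\<^bsup>2Q\<^esup>\<close> is \<open>x\<^sup>3/y\<^sup>2\<close> times the square of \<open>y \<tau>\<^sup>q\<close>, and both are \<open>-1\<close> modulo the maximal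
  ideal.
\<close>

lemma lead_x: "lead \<tau> x (- int (2 * Q)) (- 1)"
proof -
  define v where "v = y * \<tau> ^ q"
  have v: "v \<in> V" "v + 1 \<in> mm" using y_tau y_tau_unit units_iff unfolding v_def by auto
  have "(x * \<tau> ^ (2 * Q) + 1) ^ 3 = (x * \<tau> ^ (2 * Q)) ^ 3 + 1"
    using char3_add[OF three, of "x * \<tau> ^ (2 * Q)" 1 1] by simp
  also have "(x * \<tau> ^ (2 * Q)) ^ 3 = x ^ 3 * (\<tau> ^ q) ^ 2"
    by (simp add: power_mult_distrib q_Q(1) mult.commute mult.left_commute flip: power_mult)
  also have "\<dots> = x ^ 3 / y ^ 2 * v ^ 2"
    using y_nonzero by (simp add: v_def power_mult_distrib)
  also have "\<dots> + 1 = (x ^ 3 / y ^ 2 + 1) * v ^ 2 - (v + 1) * (v - 1)"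
    by (simp add: algebra_simps power2_eq_square)
  also have "\<dots> \<in> mm"
    by (intro mm_diff mm_mult x_cube V_power V_diff V_one v)
  finally have "x * \<tau> ^ (2 * Q) + 1 \<in> mm" by (rule mm_root)
  moreover have "\<tau> powi int (2 * Q) = \<tau> ^ (2 * Q)" by (rule power_int_of_nat)
  ultimately show ?thesis unfolding lead_def by simp
qed

lemma lead_mon: "lead \<tau> (mon i j k) (- int (wt i j k)) ((- 1) ^ (i + j + k))"
proof -
  have m: "- 1 \<in> V" "(- 1) ^ n \<in> V" for n using V_minus[OF V_one] V_power by auto
  note L = lead_mult[OF \<tau> lead_mult[OF \<tau> lead_power[OF \<tau> lead_x m(1), of i] lead_power[OF \<tau> lead_y m(1), of j] m(2) m(2)]
    lead_power[OF \<tau> lead_z m(1), of k] V_mult[OF m(2) m(2)] m(2)]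
  have "int i * - int (2 * Q) + int j * - int q + int k * - int (q + 1) = - int (wt i j k)"
    by (simp add: wt_def q_Q(1) algebra_simps)
  thus ?thesis using L unfolding mon_def by (simp add: power_add)
qed

text \<open>
  The pole orders of the monomials in \<open>R_span\<close> are distinct, so the pole order of an element of \<open>R\<close>
  is one of them.
\<close>

theorem R_lead:
  assumes "g \<in> R" "g \<noteq> 0"
  shows "\<exists>i j k. j < 2 \<and> k < Q \<and> (\<exists>c\<in>K - {0}. lead \<tau> g (- int (wt i j k)) c)"
proof -
  define E where "E b e \<longleftrightarrow> (\<exists>i j k. j < 2 \<and> k < Q \<and> b = mon i j k \<and> e = - int (wt i j k))" for b e
  have "\<exists>b\<in>{mon i j k | i j k. j < 2 \<and> k < Q}. \<exists>e. E b e \<and> (\<exists>c\<in>K - {0}. lead \<tau> g e c)"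
  proof (rule lincombs_lead[OF \<tau> K_subring K_V K_nonzero_mult, where E = E])
    fix b e assume "E b e"
    thus "\<exists>c\<in>K - {0}. lead \<tau> b e c" using lead_mon minus_one_K unfolding E_def by blast
  next
    fix b b' e assume "E b e" "E b' e"
    then obtain i j k i' j' k' where "j < 2" "k < Q" "b = mon i j k" "e = - int (wt i j k)"
      "j' < 2" "k' < Q" "b' = mon i' j' k'" "e = - int (wt i' j' k')" unfolding E_def by blast
    thus "b = b'" using wt_inject[of i j k i' j' k'] by auto
  qed (use R_span assms in \<open>auto simp: E_def\<close>)
  thus ?thesis unfolding E_def by blast
qed

text \<open>
  The elements of \<open>R\<close> whose pole order at infinity is less than \<open>n\<close>.
\<close>

definition weight_below :: "nat \<Rightarrow> 'f set" where
  "weight_below n = {g \<in> R. g = 0 \<or> (\<exists>w<n. \<exists>c\<in>K - {0}. lead \<tau> g (- int w) c)}"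

lemma weight_below_exhausts: "g \<in> R \<Longrightarrow> \<exists>n. g \<in> weight_below n"
  using R_lead[of g] unfolding weight_below_def by fastforce

lemma weight_below_reduce:
  assumes g: "g \<in> R" "lead \<tau> g (- int w) c" "c \<in> K - {0}"
    and m: "m \<in> R" "lead \<tau> m (- int w) d" "d \<in> K - {0}"
  shows "c / d \<in> K - {0}" "g - c / d * m \<in> weight_below w"
proof -
  show cd: "c / d \<in> K - {0}"
    using g(3) m(3) K_inverse is_subringD(5)[OF K_subring] by (simp add: divide_inverse)
  have gR: "g - c / d * m \<in> R" using cd K_R g(1) m(1) by (intro R_diff R_mult) auto
  show "g - c / d * m \<in> weight_below w"
  proof (cases "g - c / d * m = 0")
    case True thus ?thesis using R_zero by (simp add: weight_below_def)
  next
    case False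
    then obtain i j k b where b: "b \<in> K - {0}" "lead \<tau> (g - c / d * m) (- int (wt i j k)) b"
      using R_lead[OF gR] by blast
    have "lead \<tau> (g - c / d * m) (- int w) 0"
      using lead_cancel[OF \<tau> K K_V g(2) _ m(2,3)] g(3) by blast
    hence "- int w < - int (wt i j k)"
      by (rule lead_exponent_less[OF \<tau> b(2) K_unit[OF b(1)]])
    thus ?thesis using gR b unfolding weight_below_def by auto
  qed
qed

text \<open>
  Elements of the same pole order differ, up to a scalar from the finite field \<open>K\<close>, by an element of
  smaller pole order.
\<close>

lemma finite_weight_below: "finite (weight_below n)"
proof (induction n)
  case 0 thus ?case by (rule finite_subset[of _ "{0}"]) (auto simp: weight_below_def)
next
  case (Suc n)
  show ?case
  proof (cases "\<exists>m\<in>R. \<exists>d\<in>K - {0}. lead \<tau> m (- int n) d")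
    case True
    then obtain m d where m: "m \<in> R" "lead \<tau> m (- int n) d" "d \<in> K - {0}" by blast
    have "weight_below (Suc n) \<subseteq> weight_below n \<union> (\<lambda>(c, r). c * m + r) ` (K \<times> weight_below n)"
    proof
      fix g assume g: "g \<in> weight_below (Suc n)"
      show "g \<in> weight_below n \<union> (\<lambda>(c, r). c * m + r) ` (K \<times> weight_below n)"
      proof (cases "g \<in> weight_below n")
        case False
        then obtain w c where wc: "w < Suc n" "c \<in> K - {0}" "lead \<tau> g (- int w) c" "g \<in> R" "g \<noteq> 0"
          using g unfolding weight_below_def by blast
        hence "w = n" using False unfolding weight_below_def by (metis (mono_tags, lifting) less_antisym mem_Collect_eq)
        hence "c / d \<in> K - {0}" "g - c / d * m \<in> weight_below n" using weight_below_reduce[of g n c m d] wc m by auto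
        hence "(c / d, g - c / d * m) \<in> K \<times> weight_below n" by auto
        moreover have "g = (\<lambda>(c, r). c * m + r) (c / d, g - c / d * m)" by simp
        ultimately show ?thesis by blast
      qed simp
    qed
    thus ?thesis using Suc finite_K by (meson finite_SigmaI finite_UnI finite_imageI finite_subset)
  next
    case False
    hence "weight_below (Suc n) \<subseteq> weight_below n" unfolding weight_below_def by (auto simp: less_Suc_eq)
    thus ?thesis using Suc finite_subset by blast
  qed
qed

lemma weight_attained:
  assumes "n \<ge> q * q" obtains j k where "wt 0 j k = n"
proof -
  \<comment> \<open>Since \<open>y\<close> and \<open>z\<close> have pole orders \<open>q\<close> and \<open>q + 1\<close>, the number of factors \<open>z\<close> is the residue of \<open>n\<close> modulo \<open>q\<close>.\<close>
  have "n mod q < q" using q_Q(3) by simp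
  moreover have "q \<le> n div q" using assms q_Q(3) by (simp add: less_eq_div_iff_mult_less_eq)
  ultimately obtain j where j: "n div q = n mod q + j" using le_Suc_ex by (metis less_imp_le order_trans)
  have "wt 0 j (n mod q) = q * (n div q) + n mod q" unfolding j by (simp add: wt_def q_Q(1) algebra_simps)
  also have "\<dots> = n" by simp
  finally show ?thesis using that by blast
qed

text \<open>
  Every pole order from \<open>a + q\<^sup>2\<close> on is attained by a multiple of \<open>A\<close>, so leading terms can be
  subtracted down to that bound.
\<close>

lemma reduce_modulo:
  assumes A: "A \<in> R" "lead \<tau> A (- int a) cA" "cA \<in> K - {0}" and g: "g \<in> R"
  shows "\<exists>E\<in>R. g - A * E \<in> weight_below (a + q * q)"
proof -
  obtain n where "g \<in> weight_below n" using weight_below_exhausts g by blast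
  thus ?thesis
  proof (induction n arbitrary: g rule: less_induct)
    case (less n)
    show ?case
    proof (cases "g \<in> weight_below (a + q * q)")
      case True thus ?thesis using R_zero by (intro bexI[of _ 0]) auto
    next
      case False
      then obtain w c where wc: "w < n" "c \<in> K - {0}" "lead \<tau> g (- int w) c" "g \<in> R" "g \<noteq> 0"
        using less(2) unfolding weight_below_def by blast
      have "w \<ge> a + q * q"
      proof (rule ccontr)
        assume "\<not> w \<ge> a + q * q"
        hence "w < a + q * q" by simp
        hence "g \<in> weight_below (a + q * q)" using wc(2-4) unfolding weight_below_def by blast
        thus False using False by blast
      qed
      hence "w - a \<ge> q * q" by linarith
      then obtain j k where jk: "wt 0 j k = w - a" by (rule weight_attained)
      let ?m = "A * mon 0 j k" and ?d = "cA * (- 1) ^ (0 + j + k)"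
      have "lead \<tau> ?m (- int a + - int (wt 0 j k)) ?d"
        using A(3) minus_one_K K_V by (intro lead_mult[OF \<tau> A(2) lead_mon]) auto
      moreover have "- int a + - int (wt 0 j k) = - int w" using jk \<open>w \<ge> a + q * q\<close> by simp
      ultimately have m: "lead \<tau> ?m (- int w) ?d" by simp
      have d: "?d \<in> K - {0}" using K_nonzero_mult[OF A(3) minus_one_K] .
      have mR: "?m \<in> R" using A(1) mon_R R_mult by blast
      note red = weight_below_reduce[OF wc(4,3,2) mR m d]
      obtain E where E: "E \<in> R" "g - c / ?d * ?m - A * E \<in> weight_below (a + q * q)"
        using less(1)[OF wc(1) red(2)] by blast
      have "g - A * (c / ?d * mon 0 j k + E) = g - c / ?d * ?m - A * E"
        by (simp add: algebra_simps)
      moreover have "c / ?d * mon 0 j k + E \<in> R"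
        using red(1) K_R mon_R E(1) by (intro R_add R_mult) auto
      ultimately show ?thesis using E(2) by metis
    qed
  qed
qed

text \<open>
  By \<open>reduce_modulo\<close> there are only finitely many residue classes modulo \<open>A\<close>.
\<close>

lemma pigeonhole_at_infinity:
  fixes g :: "nat \<Rightarrow> 'f"
  assumes A: "A \<in> R" "A \<noteq> 0" and g: "\<And>i. g i \<in> R"
  shows "\<exists>i j. i < j \<and> (\<exists>E\<in>R. g i - g j = A * E)"
proof -
  obtain a cA where a: "lead \<tau> A (- int a) cA" "cA \<in> K - {0}" using R_lead[OF A] by blast
  have "\<forall>i. \<exists>E\<in>R. g i - A * E \<in> weight_below (a + q * q)" using reduce_modulo[OF A(1) a g] by blast
  then obtain E where E: "\<And>i. E i \<in> R" "\<And>i. g i - A * E i \<in> weight_below (a + q * q)" by metis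
  have "\<not> inj (\<lambda>i. g i - A * E i)"
  proof
    assume "inj (\<lambda>i. g i - A * E i)"
    moreover have "finite (range (\<lambda>i. g i - A * E i))"
      by (rule finite_subset[OF _ finite_weight_below[of "a + q * q"]]) (use E(2) in blast)
    ultimately show False using finite_imageD by fastforce
  qed
  then obtain i j where ij: "i \<noteq> j" "g i - A * E i = g j - A * E j" by (auto simp: inj_def)
  hence "g i - g j = A * (E i - E j)" "g j - g i = A * (E j - E i)" by (auto simp: algebra_simps)
  moreover have "E i - E j \<in> R" "E j - E i \<in> R" using E(1) R_diff by auto
  ultimately show ?thesis using ij(1) by (metis linorder_neqE_nat)
qed

lemma wt_div_mod: "wt (i mod half) j (k + Q * (i div half)) = wt i j k"
proof -
  have "wt (half * d + r) j k = wt r j (k + Q * d)" for d r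
    unfolding wt_def two_half[symmetric] by (simp add: algebra_simps)
  from this[of "i div half" "i mod half"] show ?thesis by simp
qed

text \<open>
  By \<open>wt_div_mod\<close> every pole order in \<open>R\<close> is also attained by a monomial with \<open>i < (q+1)/2\<close>, at the
  price of a higher power of \<open>z\<close>. Subtracting leading terms therefore uses such monomials only, and
  never one of larger weight than the element itself.
\<close>

theorem R_span_by_weight:
  assumes "g \<in> R" "g \<noteq> 0" "lead \<tau> g (- int w) c" "c \<in> K - {0}"
  shows "g \<in> lincombs {mon i j k | i j k. i < half \<and> j < 2 \<and> wt i j k \<le> w} K"
proof -
  have "g \<in> lincombs {mon i j k | i j k. i < half \<and> j < 2 \<and> wt i j k < n} K" if "g \<in> weight_below n" for g n
    using that
  proof (induction n arbitrary: g rule: less_induct)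
    case (less n)
    let ?I = "\<lambda>n. {mon i j k | i j k. i < half \<and> j < 2 \<and> wt i j k < n}"
    show ?case
    proof (cases "g = 0")
      case True thus ?thesis by (simp add: lincombs.zero)
    next
      case False
      then obtain w c where wc: "w < n" "c \<in> K - {0}" "lead \<tau> g (- int w) c" "g \<in> R"
        using less(2) unfolding weight_below_def by blast
      obtain i j k b where ijk: "j < 2" "b \<in> K - {0}" "lead \<tau> g (- int (wt i j k)) b"
        using R_lead[OF wc(4) False] by blast
      have w: "w = wt i j k"
        using lead_exponent_unique[OF \<tau> wc(3) K_unit[OF wc(2)] ijk(3) K_unit[OF ijk(2)]] by simp
      define i' k' where "i' = i mod half" and "k' = k + Q * (i div half)"
      have w': "wt i' j k' = w" unfolding i'_def k'_def wt_div_mod w ..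
      have i': "i' < half" unfolding i'_def using two_half by (intro mod_less_divisor) linarith
      let ?d = "(- 1) ^ (i' + j + k')"
      have m: "lead \<tau> (mon i' j k') (- int w) ?d" using lead_mon[of i' j k'] w' by simp
      note red = weight_below_reduce[OF wc(4,3,2) mon_R m minus_one_K]
      have "g - c / ?d * mon i' j k' \<in> lincombs (?I w) K" using less(1)[OF wc(1) red(2)] .
      moreover have "lincombs (?I w) K \<subseteq> lincombs (?I n) K"
        by (rule lincombs_mono) (use wc(1) in fastforce)
      ultimately have 1: "g - c / ?d * mon i' j k' \<in> lincombs (?I n) K" by blast
      have "mon i' j k' \<in> lincombs (?I n) K"
        by (rule lincombs_base[OF K_subring]) (use i' ijk(1) w' wc(1) in blast)
      hence 2: "c / ?d * mon i' j k' \<in> lincombs (?I n) K"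
        using lincombs_mult[OF K_subring] red(1) by blast
      show ?thesis using lincombs_add[OF 1 2] by simp
    qed
  qed
  moreover have "g \<in> weight_below (Suc w)" using assms unfolding weight_below_def by blast
  ultimately have "g \<in> lincombs {mon i j k | i j k. i < half \<and> j < 2 \<and> wt i j k < Suc w} K" by blast
  thus ?thesis by (simp add: less_Suc_eq_le)
qed

lemma uniformizer_tau: "uniformizer \<tau>"
proof -
  have R_unit: "\<exists>e. \<exists>u\<in>units. g = \<tau> powi e * u" if "g \<in> R" "g \<noteq> 0" for g
    using R_lead[OF that] lead_unit[OF \<tau>] K_unit by metis
  have "\<exists>e. \<exists>u\<in>units. f = \<tau> powi e * u" if f: "f \<noteq> 0" for f
  proof -
    obtain A B where AB: "A \<in> R" "B \<in> R" "B \<noteq> 0" "f = A / B" by (rule fraction)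
    obtain d u where u: "u \<in> units" "A = \<tau> powi d * u" using R_unit[of A] AB f by auto
    obtain e v where v: "v \<in> units" "B = \<tau> powi e * v" using R_unit[of B] AB f by auto
    have "f = \<tau> powi (d - e) * (u / v)"
      using AB u v \<tau> by (simp add: power_int_diff)
    thus ?thesis using units_divide u v by blast
  qed
  thus ?thesis using \<tau> by (simp add: uniformizer_def)
qed

end

context z3
begin

theorem R_pigeonhole:
  fixes g :: "nat \<Rightarrow> 'f"
  assumes "A \<in> R" "A \<noteq> 0" "\<And>i. g i \<in> R"
  shows "\<exists>i j. i < j \<and> (\<exists>E\<in>R. g i - g j = A * E)"
proof -
  obtain V where "place_over V" "y \<notin> V" using exists_infinite_place by blast
  then interpret z3_infinite t K x y V0 V by unfold_locales
  show ?thesis by (rule pigeonhole_at_infinity[OF assms])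
qed

end

section \<open>Finite places\<close>

context z3
begin

text \<open>
  Raising to the power \<open>N e\<close> is a ring endomorphism that fixes \<open>K\<close>.
\<close>

definition N :: "nat \<Rightarrow> nat" where "N e = card K ^ e"

lemma N_power_3: "N e = 3 ^ (2 * t * e)"
  by (simp add: N_def card_K mult.commute mult.left_commute flip: power_mult)

lemma N_gt_1: "e > 0 \<Longrightarrow> N e > 1"
  unfolding N_power_3 using t by (intro one_less_power) auto

lemma K_power_N: "c \<in> K \<Longrightarrow> c ^ N e = c"
  unfolding N_def by (induction e) (auto simp: power_mult K_power)

lemma N_add: "(u + v :: 'f) ^ N e = u ^ N e + v ^ N e"
  unfolding N_power_3 by (rule char3_add[OF three])

lemma N_diff: "(u - v :: 'f) ^ N e = u ^ N e - v ^ N e"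
  unfolding N_power_3 by (rule char3_diff[OF three])

text \<open>
  The elements fixed by an endomorphism modulo an ideal form a ring.
\<close>

lemma fixed_mod_subring:
  assumes s: "s \<in> R"
  shows "is_subring {g \<in> R. \<exists>E\<in>R. g ^ N e - g = s * E}" (is "is_subring ?G")
proof -
  have "u + v \<in> ?G \<and> u - v \<in> ?G \<and> u * v \<in> ?G" if uv: "u \<in> ?G" "v \<in> ?G" for u v
  proof -
    obtain E F where EF: "E \<in> R" "F \<in> R" "u ^ N e - u = s * E" "v ^ N e - v = s * F" "u \<in> R" "v \<in> R"
      using uv by blast
    have "(u + v) ^ N e - (u + v) = s * (E + F)" "(u - v) ^ N e - (u - v) = s * (E - F)"
      using EF(3,4) by (auto simp: N_add N_diff algebra_simps)
    moreover have "(u * v) ^ N e - u * v = u ^ N e * (v ^ N e - v) + v * (u ^ N e - u)"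
      by (simp add: power_mult_distrib algebra_simps)
    hence "(u * v) ^ N e - u * v = s * (u ^ N e * F + v * E)"
      unfolding EF(3,4) by (simp add: algebra_simps)
    moreover have "E + F \<in> R" "E - F \<in> R" "u ^ N e * F + v * E \<in> R" "u + v \<in> R" "u - v \<in> R" "u * v \<in> R"
      using EF by (auto intro: R_add R_diff R_mult R_power)
    ultimately show ?thesis by blast
  qed
  moreover have "1 \<in> ?G" using R_one R_zero by (auto intro!: bexI[of _ 0])
  ultimately show ?thesis unfolding is_subring_def by blast
qed

lemma p_Ky: "p \<in> ring_adjoin K y"
  unfolding p_def p_fun_def
  by (intro is_subring_sum[OF Ky_subring] is_subringD(7)[OF Ky_subring] ring_adjoin_base(2)[OF K_subring])

text \<open>
  Applying \<open>x\<^sup>q = -x - p\<^sup>2\<close> twice gives \<open>x\<close> raised to the power \<open>q\<^sup>2 = |K|\<close> as \<open>x\<close> plus a polynomial in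
  \<open>y\<close>; the sign of \<open>x\<close> is restored because the exponent is a square.
\<close>

lemma x_power_N: "x ^ N e - x \<in> ring_adjoin K y"
proof (induction e)
  case 0 show ?case using is_subringD(2)[OF Ky_subring] by (simp add: N_def)
next
  case (Suc e)
  note Ky = is_subringD[OF Ky_subring]
  have "x ^ card K = (x ^ q) ^ q" by (simp add: card_K q_def power2_eq_square power_mult)
  also have "\<dots> = (- x - p ^ 2) ^ q" by (simp only: xq)
  also have "\<dots> = - (x ^ q) - (p ^ 2) ^ q"
    unfolding q_def by (simp only: char3_diff[OF three] char3_uminus)
  also have "\<dots> = x + p ^ 2 - (p ^ 2) ^ q" by (simp add: xq)
  finally have 1: "x ^ card K = x + (p ^ 2 - (p ^ 2) ^ q)" by simp
  have "x ^ N (Suc e) = (x + (x ^ N e - x)) ^ N 1" by (simp add: N_def mult.commute flip: power_mult)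
  also have "\<dots> = x ^ card K + (x ^ N e - x) ^ card K" unfolding N_add by (simp add: N_def)
  finally have "x ^ N (Suc e) - x = (p ^ 2 - (p ^ 2) ^ q) + (x ^ N e - x) ^ card K"
    using 1 by simp
  also have "\<dots> \<in> ring_adjoin K y" using Suc p_Ky Ky(3,4,7) by presburger
  finally show ?case .
qed

lemma N_triple: "N (3 * e) = N e * N e * N e"
  by (simp add: N_def power_mult power3_eq_cube power_mult_distrib)

text \<open>
  Modulo \<open>s = y\<^sup>N - y\<close> the \<open>N\<close>-th power fixes \<open>K[y]\<close> and moves \<open>x\<close> by an element \<open>d \<in> K[y]\<close>. Three
  applications move \<open>x\<close> by \<open>3d = 0\<close>.
\<close>

theorem frobenius_fixes_residues:
  assumes "g \<in> R"
  shows "\<exists>E\<in>R. g ^ N (3 * e) - g = (y ^ N e - y) * E"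
proof -
  define s where "s = y ^ N e - y"
  have sR: "s \<in> R" unfolding s_def by (intro R_diff R_power y_R)
  have Npos: "N e > 0" by (simp add: N_power_3)
  have iter: "g ^ N (3 * e) = g + d + d ^ N e + (d ^ N e) ^ N e" if "g ^ N e = g + d" for g d :: 'f
  proof -
    have "g ^ N (3 * e) = ((g ^ N e) ^ N e) ^ N e" by (simp only: N_triple power_mult)
    thus ?thesis unfolding that N_add by (simp add: algebra_simps)
  qed
  have pow: "s ^ N e = s * s ^ (N e - 1)" using Npos by (metis power_minus_mult mult.commute)
  have y: "\<exists>E\<in>R. y ^ N (3 * e) - y = s * E"
  proof -
    have "y ^ N (3 * e) = y + s + s ^ N e + (s ^ N e) ^ N e" by (rule iter) (simp add: s_def)
    also have "(s ^ N e) ^ N e = s * (s ^ (N e - 1) * (s ^ N e) ^ (N e - 1))"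
      using Npos pow by (metis mult.assoc power_minus_mult mult.commute)
    finally have "y ^ N (3 * e) - y = s * (1 + s ^ (N e - 1) + s ^ (N e - 1) * (s ^ N e) ^ (N e - 1))"
      using pow by (simp add: algebra_simps)
    moreover have "1 + s ^ (N e - 1) + s ^ (N e - 1) * (s ^ N e) ^ (N e - 1) \<in> R"
      by (intro R_add R_mult R_power R_one sR)
    ultimately show ?thesis by blast
  qed
  have x: "\<exists>E\<in>R. x ^ N (3 * e) - x = s * E"
  proof -
    define d where "d = x ^ N e - x"
    have "ring_adjoin K y \<subseteq> {g \<in> R. \<exists>E\<in>R. g ^ N e - g = s * E}"
    proof (rule ring_adjoin_least[OF fixed_mod_subring[OF sR]])
      show "K \<subseteq> {g \<in> R. \<exists>E\<in>R. g ^ N e - g = s * E}"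
        using K_R K_power_N R_zero by (auto intro!: bexI[of _ 0])
      show "y \<in> {g \<in> R. \<exists>E\<in>R. g ^ N e - g = s * E}"
        using y_R R_one by (auto simp: s_def intro!: bexI[of _ 1])
    qed
    then obtain E where E: "E \<in> R" "d ^ N e - d = s * E"
      using x_power_N unfolding d_def by blast
    hence dN: "d ^ N e = d + s * E" by (simp add: algebra_simps)
    have "x ^ N (3 * e) = x + d + d ^ N e + (d ^ N e) ^ N e" by (rule iter) (simp add: d_def)
    also have "(d ^ N e) ^ N e = d + s * E + s ^ N e * E ^ N e"
      unfolding dN N_add by (simp add: dN power_mult_distrib)
    also have "x + d + d ^ N e + (d + s * E + s ^ N e * E ^ N e)
       = x + 3 * d + s * (2 * E + s ^ (N e - 1) * E ^ N e)"
      unfolding dN pow by (simp add: algebra_simps)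
    finally have xN: "x ^ N (3 * e) = x + 3 * d + s * (2 * E + s ^ (N e - 1) * E ^ N e)" .
    have "x ^ N (3 * e) - x = s * (E + E + s ^ (N e - 1) * E ^ N e)"
      unfolding xN three by (simp only: mult_zero_left add_0_right mult_2 add_diff_cancel_left')
    moreover have "E + E + s ^ (N e - 1) * E ^ N e \<in> R" by (intro R_add R_mult R_power sR E(1))
    ultimately show ?thesis by blast
  qed
  have "R \<subseteq> {g \<in> R. \<exists>E\<in>R. g ^ N (3 * e) - g = s * E}"
    by (rule R_least[OF fixed_mod_subring[OF sR]])
      (use K_R K_power_N R_zero x_R y_R x y in \<open>auto intro!: bexI[of _ 0]\<close>)
  thus ?thesis using assms unfolding s_def by blast
qed

end

locale z3_finite = z3 t K x y V0 for t K and x y :: "'f::field" and V0 +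
  fixes V :: "'f set"
  assumes V: "place_over V" and y_V: "y \<in> V"
begin

sublocale valring V using V by unfold_locales (simp add: place_over_def)

lemma K_V: "K \<subseteq> V" using V by (simp add: place_over_def)

lemma p_V: "p \<in> V" unfolding p_def p_fun_def by (intro is_subring_sum[OF subring] V_power y_V)

text \<open>
  \<open>x\<close> is integral over \<open>K[y]\<close>.
\<close>

lemma x_V: "x \<in> V"
proof (rule ccontr)
  assume x: "x \<notin> V"
  have "x \<noteq> 0" using x V_zero by auto
  hence "x ^ q * (1 + inverse x ^ (q - 1)) = x ^ q + x"
    using q_Q(3) by (intro add_self_factor_inverse) simp_all
  also have "\<dots> = - (p ^ 2)" using xq by simp
  finally have "x ^ q * (1 + inverse x ^ (q - 1)) \<in> V" using V_minus V_power p_V by simp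
  moreover have "x ^ q * (1 + inverse x ^ (q - 1)) \<notin> V"
    using q_Q(3)
    by (intro not_V_mult_unit not_V_power x units_add_mm one_unit mm_power inverse_mm) auto
  ultimately show False by blast
qed

lemma R_V: "R \<subseteq> V" by (rule R_least[OF subring K_V x_V y_V])

text \<open>
  The element \<open>s\<close> generates the maximal ideal of the localization of \<open>R\<close> at the place. For \<open>A\<close> in
  the maximal ideal, the congruence \<open>frobenius_fixes_residues\<close> exhibits \<open>A (1 - A\<^sup>M)\<close> as a multiple of
  \<open>s\<close>, and \<open>1 - A\<^sup>M\<close> is a unit. Dividing out \<open>s\<close> terminates: two powers of \<open>s\<close> agree modulo \<open>A\<close> by
  \<open>R_pigeonhole\<close>, so \<open>A\<close> divides a power of \<open>s\<close> times a unit.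
\<close>

lemma finite_place_factorization:
  assumes s: "s \<in> R" "s \<in> mm" "s \<noteq> 0" and e: "e > 0" and sy: "E0 \<in> R" "y ^ N e - y = s * E0"
    and A: "A \<in> R" "A \<noteq> 0"
  shows "\<exists>j. \<exists>U\<in>R \<inter> units. \<exists>W\<in>R \<inter> units. A * W = s ^ j * U"
proof -
  define M where "M = N (3 * e) - 1"
  have M: "M > 0" "N (3 * e) = Suc M" using N_gt_1[of "3 * e"] e by (auto simp: M_def)
  \<comment> \<open>Induction on the power of \<open>s\<close> that \<open>A\<close> divides up to a unit.\<close>
  have step: "\<exists>j. \<exists>U\<in>R \<inter> units. \<exists>W\<in>R \<inter> units. A * W = s ^ j * U"
    if "A \<in> R" "D \<in> R" "B \<in> R \<inter> units" "A * D = s ^ k * B" for A D B k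
    using that
  proof (induction k arbitrary: A D B)
    case 0
    hence "A \<notin> mm" using mm_mult[of A D] R_V by (auto simp: units_def)
    hence "A \<in> R \<inter> units" using 0 R_V by (auto simp: units_def)
    thus ?case using R_one one_unit by (intro exI[of _ 0] bexI[of _ A] bexI[of _ 1]) auto
  next
    case (Suc k)
    show ?case
    proof (cases "A \<in> mm")
      case False
      hence "A \<in> R \<inter> units" using Suc R_V by (auto simp: units_def)
      thus ?thesis using R_one one_unit by (intro exI[of _ 0] bexI[of _ A] bexI[of _ 1]) auto
    next
      case True
      obtain E where E: "E \<in> R" "A ^ N (3 * e) - A = (y ^ N e - y) * E"
        using frobenius_fixes_residues[OF Suc(2)] by blast
      define C where "C = - (E0 * E)"
      define u where "u = 1 - A ^ M"
      have CR: "C \<in> R" unfolding C_def using is_subringD(6)[OF R_subring] R_mult sy(1) E(1) by blast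
      have "A * u = s * C" using E(2) unfolding u_def C_def sy(2) M(2) by (simp add: algebra_simps)
      moreover have u: "u \<in> R \<inter> units"
        using units_add_mm[OF one_unit mm_minus[OF mm_power[OF True M(1)]]] Suc(2) R_diff R_one R_power
        unfolding u_def by simp
      ultimately have Au: "A * u = s * C" "u \<in> R \<inter> units" by auto
      have "s * (C * D) = (A * u) * D" unfolding Au(1) by (simp only: mult.assoc)
      also have "\<dots> = (A * D) * u" by (simp only: mult_ac)
      also have "\<dots> = s * (s ^ k * (B * u))" unfolding Suc(5) by simp
      finally have "C * D = s ^ k * (B * u)" using s(3) by (simp only: mult_cancel_left) simp
      moreover have "B * u \<in> R \<inter> units" using Suc(4) u R_mult units_mult by blast
      ultimately obtain j U W where UW: "U \<in> R \<inter> units" "W \<in> R \<inter> units" "C * W = s ^ j * U"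
        using Suc(1)[OF CR Suc(3)] by blast
      have "A * (u * W) = s ^ Suc j * U"
        using \<open>A * u = s * C\<close> UW(3) by (metis mult.assoc power_Suc)
      moreover have "u * W \<in> R \<inter> units" using u UW R_mult units_mult by blast
      ultimately show ?thesis using UW by blast
    qed
  qed
  obtain i j E where E: "i < j" "E \<in> R" "s ^ i - s ^ j = A * E"
    using R_pigeonhole[OF A, of "\<lambda>i. s ^ i"] R_power s by blast
  have "s ^ j = s ^ i * s ^ (j - i)" using E(1) by (simp flip: power_add)
  hence "A * E = s ^ i * (1 - s ^ (j - i))" using E(3) by (simp add: algebra_simps)
  moreover have "1 - s ^ (j - i) \<in> R \<inter> units"
    using units_add_mm[OF one_unit mm_minus[OF mm_power[OF s(2), of "j - i"]]] E(1) R_diff R_one R_power s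
    by simp
  ultimately show ?thesis using step[OF A(1) E(2)] by blast
qed

lemma finite_place_fraction:
  assumes s: "s \<in> R" "s \<in> mm" "s \<noteq> 0" and e: "e > 0" and sy: "E0 \<in> R" "y ^ N e - y = s * E0"
    and f: "f \<noteq> 0"
  shows "\<exists>j. \<exists>U\<in>R \<inter> units. \<exists>W\<in>R \<inter> units. f = s powi j * (U / W)"
proof -
  obtain A B where AB: "A \<in> R" "B \<in> R" "B \<noteq> 0" "f = A / B" by (rule fraction)
  note fact = finite_place_factorization[OF s e sy]
  obtain i U W where U: "U \<in> R \<inter> units" "W \<in> R \<inter> units" "A * W = s ^ i * U" using fact[of A] AB f by auto
  obtain j U' W' where U': "U' \<in> R \<inter> units" "W' \<in> R \<inter> units" "B * W' = s ^ j * U'" using fact[of B] AB by auto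
  have nz: "W \<noteq> 0" "W' \<noteq> 0" "U' \<noteq> 0" using U U' by (auto simp: units_iff)
  have "A = s ^ i * U / W" "B = s ^ j * U' / W'" using U(3) U'(3) nz by (auto simp: eq_divide_imp)
  hence "f = (s ^ i * U / W) / (s ^ j * U' / W')" using AB(4) by (simp only:)
  also have "\<dots> = s powi (int i - int j) * (U * W' / (W * U'))"
    using nz s(3) by (simp add: power_int_diff field_simps)
  finally have "f = s powi (int i - int j) * (U * W' / (W * U'))" .
  moreover have "U * W' \<in> R \<inter> units" "W * U' \<in> R \<inter> units" using U U' R_mult units_mult by blast+
  ultimately show ?thesis by blast
qed

lemma finite_place_uniformizer:
  assumes s: "s \<in> R" "s \<in> mm" "s \<noteq> 0" and e: "e > 0" and sy: "E0 \<in> R" "y ^ N e - y = s * E0"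
  shows "uniformizer s"
  unfolding uniformizer_def using s finite_place_fraction[OF assms] units_divide by (metis IntD2)

text \<open>
  Two of the iterated \<open>|K|\<close>-th powers of \<open>y\<close> agree modulo \<open>A\<close>, and their difference is itself
  a power of some \<open>y - y\<^sup>N\<close>.
\<close>

lemma exists_power_in_mm:
  assumes "A \<in> R" "A \<in> mm" "A \<noteq> 0"
  shows "\<exists>e>0. y ^ N e - y \<in> mm \<and> y ^ N e - y \<noteq> 0"
proof -
  obtain i j E where E: "i < j" "E \<in> R" "y ^ N i - y ^ N j = A * E"
    using R_pigeonhole[OF assms(1,3), of "\<lambda>i. y ^ N i"] R_power y_R by blast
  have "N j = N (j - i) * N i" using E(1) by (simp add: N_def flip: power_add)
  hence "(y - y ^ N (j - i)) ^ N i = A * E" using E(3) by (simp add: N_diff power_mult)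
  hence "(y - y ^ N (j - i)) ^ N i \<in> mm" using mm_mult[OF assms(2)] E(2) R_V by auto
  hence "y - y ^ N (j - i) \<in> mm" by (rule mm_root)
  hence "y ^ N (j - i) - y \<in> mm" using mm_minus by fastforce
  moreover have "y ^ N (j - i) \<noteq> y ^ 1"
  proof
    assume "y ^ N (j - i) = y ^ 1"
    hence "N (j - i) = 1" by (rule y_powers_distinct)
    thus False using N_gt_1[of "j - i"] E(1) by simp
  qed
  ultimately show ?thesis using E(1) by (intro exI[of _ "j - i"]) auto
qed

lemma R_mm_nonzero:
  assumes "V \<noteq> UNIV" shows "\<exists>A\<in>R. A \<in> mm \<and> A \<noteq> 0"
proof -
  obtain f where f: "f \<notin> V" using assms by blast
  obtain A B where AB: "A \<in> R" "B \<in> R" "B \<noteq> 0" "f = A / B" by (rule fraction)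
  have "B \<in> mm"
  proof (rule ccontr)
    assume "B \<notin> mm"
    hence "inverse B \<in> V" using AB R_V units_iff by (auto simp: units_def)
    thus False using f AB R_V V_mult by (auto simp: divide_inverse)
  qed
  thus ?thesis using AB by blast
qed

lemma exists_uniformizer:
  assumes "V \<noteq> UNIV" shows "\<exists>s. uniformizer s"
proof -
  obtain e where e: "e > 0" "y ^ N e - y \<in> mm" "y ^ N e - y \<noteq> 0"
    using R_mm_nonzero[OF assms] exists_power_in_mm by blast
  have "y ^ N e - y \<in> R" by (intro R_diff R_power y_R)
  thus ?thesis using finite_place_uniformizer[OF _ e(2,3,1) R_one] by auto
qed

text \<open>
  The calculation behind the choice of \<open>z\<close>, carried out modulo the maximal ideal. In characteristic three
  \<open>z = x (x + 1)\<^sup>2 + y\<^sup>2\<close>, so at a zero of \<open>z\<close> the element \<open>r = -y/(x + 1)\<close> satisfies \<open>r\<^sup>2 = -x\<close> and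
  \<open>r\<^sup>3 - r = y\<close>. Then \<open>p = r\<^sup>q - r\<close>, and the equation of the curve becomes \<open>r\<^bsup>q+1\<^esup> = 0\<close>.
\<close>

lemma z_zero:
  assumes z: "z \<in> mm"
  shows "x \<in> mm \<and> y \<in> mm"
proof -
  have three': "3 = (0::'f)" by (rule three)
  have "z + 3 * x ^ 2 = x * (x + 1) ^ 2 + y ^ 2" unfolding z_def by algebra
  hence zf: "z = x * (x + 1) ^ 2 + y ^ 2" by (simp only: three mult_zero_left add_0_right)
  \<comment> \<open>At a point with \<open>x = -1\<close> a zero of \<open>z\<close> would have \<open>y = 0\<close>, off the curve.\<close>
  have x1: "x + 1 \<in> units"
  proof (rule ccontr)
    assume "x + 1 \<notin> units"
    hence x1: "x + 1 \<in> mm" using x_V V_add V_one by (auto simp: units_def)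
    have "y ^ 2 = z - (x + 1) * (x * (x + 1))" using zf by (simp add: power2_eq_square algebra_simps)
    also have "\<dots> \<in> mm" using z x1 x_V by (intro mm_diff mm_mult V_mult V_add V_one) auto
    finally have "y \<in> mm" by (rule mm_root)
    hence "p ^ 2 \<in> mm" unfolding p_def p_fun_def by (intro mm_power mm_sum) auto
    moreover have "(x + 1) ^ q + (x + 1) - (x ^ q + x) = 3 - 1"
      unfolding q_def char3_add[OF three] by simp
    hence "(x + 1) ^ q + (x + 1) + p ^ 2 = - 1" using xq three' by (simp add: algebra_simps)
    moreover have "(x + 1) ^ q \<in> mm" using x1 q_Q(3) by (intro mm_power) auto
    ultimately have "- 1 \<in> mm" using x1 mm_add by metis
    thus False using mm_minus[of "- 1"] one_notin_mm by simp
  qed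
  have x1': "x + 1 \<noteq> 0" using x1 units_iff by blast
  define r where "r = - y / (x + 1)"
  have rV: "r \<in> V" unfolding r_def divide_inverse using x1 y_V units_iff V_mult V_minus by blast
  have ry: "r * (x + 1) = - y" unfolding r_def using x1' by simp
  have "(r ^ 2 + x) * (x + 1) ^ 2 = z"
  proof -
    have "(r ^ 2 + x) * (x + 1) ^ 2 = (r * (x + 1)) ^ 2 + x * (x + 1) ^ 2"
      by (simp only: distrib_right power_mult_distrib)
    also have "\<dots> = z" unfolding ry zf by (simp only: power2_minus add.commute)
    finally show ?thesis .
  qed
  hence "r ^ 2 + x = z * inverse ((x + 1) ^ 2)" using x1' by (simp add: field_simps)
  also have "\<dots> \<in> mm" using z x1 units_power units_iff by (intro mm_mult) blast+
  finally have rx: "r ^ 2 + x \<in> mm" .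
  \<comment> \<open>The error terms of the congruences for \<open>y\<close> and \<open>x\<close>.\<close>
  define m where "m = r * (r ^ 2 + x)"
  define n where "n = r ^ 2 + x"
  have m: "m \<in> mm" unfolding m_def using rV rx mm_mult2 by blast
  have "r ^ 3 - r - m = - (r * (x + 1))"
    unfolding m_def by (simp add: algebra_simps power3_eq_cube power2_eq_square)
  hence "y = r ^ 3 - r - m" using ry by simp
  moreover have "p_fun t (r ^ 3 - r) = r ^ q - r"
  proof -
    have "p_fun t (r ^ 3) = p_fun t r ^ 3"
      using char3_sum[OF three, of "\<lambda>i. r ^ 3 ^ i" "{..<t}" 1]
      by (simp add: p_fun_def mult.commute flip: power_mult)
    thus ?thesis unfolding p_fun_diff[OF three] using p_fun_cube[OF three, of t r] by (simp add: q_def)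
  qed
  ultimately have p: "p = r ^ q - r - p_fun t m" unfolding p_def by (simp add: p_fun_diff[OF three])
  have pm: "p_fun t m \<in> mm" unfolding p_fun_def by (intro mm_sum mm_power m) simp
  have xn: "x = n - r ^ 2" by (simp add: n_def)
  have "x ^ q = n ^ q - (r ^ q) ^ 2"
    unfolding xn q_def by (simp add: char3_diff[OF three] mult.commute flip: power_mult)
  hence "n ^ q - (r ^ q) ^ 2 + (n - r ^ 2) + (r ^ q - r - p_fun t m) ^ 2 = 0"
    using xq p xn by simp
  moreover have "\<alpha> * r = - \<nu> - n + \<mu> * (2 * (\<alpha> - r) - \<mu>) + 3 * (\<alpha> * r)"
    if "\<nu> - \<alpha> ^ 2 + (n - r ^ 2) + (\<alpha> - r - \<mu>) ^ 2 = 0" for \<alpha> \<mu> \<nu> :: 'f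
    using that by algebra
  ultimately have "r ^ q * r = - (n ^ q) - n + p_fun t m * (2 * (r ^ q - r) - p_fun t m) + 3 * (r ^ q * r)"
    by blast
  also have "\<dots> \<in> mm"
  proof -
    have "n \<in> mm" using rx n_def by simp
    hence "- (n ^ q) - n \<in> mm" using q_Q(3) by (intro mm_diff mm_minus mm_power) auto
    moreover have "p_fun t m * ((r ^ q - r) + (r ^ q - r) - p_fun t m) \<in> mm"
      using pm rV mm_V by (intro mm_mult V_diff V_add V_power) auto
    ultimately show ?thesis unfolding three mult_2 mult_zero_left add_0_right by (rule mm_add)
  qed
  finally have "r ^ Suc q \<in> mm" by (simp add: mult.commute)
  hence r: "r \<in> mm" by (rule mm_root)
  have "y = - (r * (x + 1))" using ry by simp
  moreover have "r * (x + 1) \<in> mm" using r x_V V_add V_one by (intro mm_mult) auto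
  ultimately have "y \<in> mm" using mm_minus by metis
  moreover have "n - r ^ 2 \<in> mm" using rx mm_power[OF r, of 2] unfolding n_def by (intro mm_diff) auto
  hence "x \<in> mm" unfolding xn[symmetric] .
  ultimately show ?thesis by blast
qed

end

context z3
begin

text \<open>
  The denominators of \<open>f\<close> form an ideal \<open>I\<close> of \<open>R\<close>. If it were proper, some place would be centred on
  it; there \<open>f\<close> is regular, so by \<open>finite_place_fraction\<close> it has a denominator that is a unit at this
  place, although all denominators lie in the maximal ideal.
\<close>

theorem regular_outside_infinity_in_R:
  assumes reg: "\<And>V. place_over V \<Longrightarrow> y \<in> V \<Longrightarrow> f \<in> V"
  shows "f \<in> R"
proof (rule ccontr)
  assume f: "f \<notin> R"
  define I where "I = {B \<in> R. B * f \<in> R}"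
  have "lincombs I R \<subseteq> I"
  proof
    fix u assume "u \<in> lincombs I R" thus "u \<in> I"
    proof induction
      case zero thus ?case using R_zero by (simp add: I_def)
    next
      case (step i b u)
      have "(i * b + u) * f = b * (i * f) + u * f" by (simp add: algebra_simps)
      thus ?case using step unfolding I_def by (auto intro: R_add R_mult)
    qed
  qed
  moreover have "1 \<notin> I" using f by (simp add: I_def)
  ultimately have "1 \<notin> lincombs I R" by blast
  moreover have "I \<subseteq> R" by (auto simp: I_def)
  ultimately obtain V where dom: "is_valring V" "R \<subseteq> V" "I \<subseteq> max_ideal V"
    using exists_dominating_valring[OF R_subring] by blast
  interpret z3_finite t K x y V0 V
    using dom K_R y_R by unfold_locales (auto simp: place_over_def)
  obtain A B where AB: "A \<in> R" "B \<in> R" "B \<noteq> 0" "f = A / B" by (rule fraction)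
  hence "B \<in> I" by (simp add: I_def)
  hence "B \<in> mm" using dom by blast
  then obtain e where e: "e > 0" "y ^ N e - y \<in> mm" "y ^ N e - y \<noteq> 0"
    using exists_power_in_mm AB by blast
  define s where "s = y ^ N e - y"
  have sR: "s \<in> R" unfolding s_def by (intro R_diff R_power y_R)
  have s: "s \<in> mm" "s \<noteq> 0" "y ^ N e - y = s * 1" using e by (auto simp: s_def)
  have f0: "f \<noteq> 0" using f R_zero by auto
  obtain j U W where UW: "U \<in> R \<inter> units" "W \<in> R \<inter> units" "f = s powi j * (U / W)"
    using finite_place_fraction[OF sR s(1,2) e(1) R_one s(3) f0] by blast
  have "U / W \<in> units" using UW units_divide by blast
  moreover have "f \<in> V" using reg[OF V y_V] by blast
  ultimately have "j \<ge> 0"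
    using uniformizer_nonneg(1)[OF finite_place_uniformizer[OF sR s(1,2) e(1) R_one s(3)]] UW(3) by blast
  hence "s powi j = s ^ nat j" by (simp add: power_int_def)
  moreover have "W \<noteq> 0" using UW by (simp add: units_iff)
  ultimately have "W * f = s ^ nat j * U" using UW(3) by simp
  hence "W \<in> I" using UW sR R_mult R_power unfolding I_def by auto
  thus False using dom(3) UW(2) unfolding units_def by blast
qed

end

section \<open>Functions with a single pole at the origin\<close>

lemma generated_submonoid_closed:
  "0 \<in> generated_submonoid A" "A \<subseteq> generated_submonoid A"
  "m \<in> generated_submonoid A \<Longrightarrow> n \<in> generated_submonoid A \<Longrightarrow> m + n \<in> generated_submonoid A"
  "m \<in> generated_submonoid A \<Longrightarrow> k * m \<in> generated_submonoid A"
proof -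
  have sub: "is_submonoid (generated_submonoid A)"
    unfolding generated_submonoid_def by (rule hull_in) (auto simp: is_submonoid_def)
  thus zero: "0 \<in> generated_submonoid A"
    and add: "m \<in> generated_submonoid A \<Longrightarrow> n \<in> generated_submonoid A \<Longrightarrow> m + n \<in> generated_submonoid A"
    for m n by (auto simp: is_submonoid_def)
  show "A \<subseteq> generated_submonoid A" unfolding generated_submonoid_def by (rule hull_subset)
  show "m \<in> generated_submonoid A \<Longrightarrow> k * m \<in> generated_submonoid A"
    by (induction k) (auto intro: zero add)
qed

context z3
begin

text \<open>
  Writing \<open>i = 3s + r\<close> with \<open>r < 3\<close>, the function \<open>x\<^sup>i y\<^sup>j/z\<^sup>m\<close> is a product of \<open>s\<close> factors
  \<open>x\<^sup>3/z\<^sup>2\<close>, \<open>r\<close> factors \<open>x/z\<close>, \<open>j\<close> factors \<open>y/z\<close> and \<open>m - (2s + r + j)\<close> factors \<open>1/z\<close>. The point is that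
  the last number is nonnegative. If not, the pole order condition gives \<open>3Q \<le> m + Qr\<close>, which
  \<open>2i + 1 \<le> q\<close> rules out; for \<open>r = 2\<close> this also uses that \<open>Q\<close> is odd.
\<close>

lemma pole_number_combination:
  assumes i: "i < half" and j: "j < 2" and m: "Q * (2 * i + 3 * j) \<le> (q + 1) * m"
    and n: "n + 2 * i + j = (q + 1) * m"
  shows "n \<in> generated_submonoid {q, q + 1, q - 1, 2 * q - 4}"
proof -
  define s r where "s = i div 3" and "r = i mod 3"
  have ir: "i = 3 * s + r" "r < 3" by (auto simp: s_def r_def)
  have i_le: "2 * i + 1 \<le> 3 * Q" using i two_half q_Q(1) by linarith
  obtain d where d: "Q = 2 * d + 1" using odd_q q_Q(1) by (metis even_mult_iff oddE)
  have "2 * s + r + j \<le> m"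
  proof (rule ccontr)
    assume "\<not> ?thesis"
    then obtain e where e: "2 * s + r + j = m + 1 + e" by (metis Suc_eq_plus1 add.commute less_imp_Suc_add not_le add_Suc_right)
    have "Q * (2 * i + 3 * j) \<le> 3 * (Q * m) + m" using m q_Q(1) by (simp add: algebra_simps)
    moreover have "Q * (2 * i + 3 * j) = 3 * (Q * (2 * s + r + j)) - Q * r"
      unfolding ir(1) by (simp add: algebra_simps)
    moreover have "Q * (2 * s + r + j) = Q * m + Q + Q * e" unfolding e by (simp add: algebra_simps)
    moreover have "Q * r \<le> Q * 2" using ir(2) by simp
    ultimately have Qm: "3 * Q \<le> m + Q * r" by linarith
    consider "r = 0" | "r = 1" | "r = 2" using ir(2) by linarith
    thus False
    proof cases
      case 1 thus ?thesis using Qm e ir(1) i_le j by simp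
    next
      case 2 thus ?thesis using Qm e ir(1) i_le j q_Q(2) by simp
    next
      case 3
      have "6 * s + 5 \<le> 6 * d + 3" using i_le 3 d ir(1) by simp
      hence "s < d" by linarith
      thus ?thesis using Qm e j d 3 by simp
    qed
  qed
  then obtain l where l: "m = 2 * s + r + j + l" using le_Suc_ex by blast
  have q4: "2 * q - 4 + 6 = 2 * q + 2" "q - 1 + 2 = q + 1" using q_Q(3) by auto
  have "s * (2 * q - 4) + 6 * s = s * (2 * q + 2)" "r * (q - 1) + 2 * r = r * (q + 1)"
    unfolding q4[symmetric] by (simp_all add: algebra_simps)
  moreover have "(q + 1) * m = s * (2 * q + 2) + r * (q + 1) + j * q + j + l * (q + 1)"
    unfolding l by (simp add: algebra_simps)
  ultimately have eq: "n = s * (2 * q - 4) + r * (q - 1) + j * q + l * (q + 1)"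
    using n ir(1) by linarith
  show ?thesis unfolding eq
    by (intro generated_submonoid_closed(3,4) subsetD[OF generated_submonoid_closed(2)]) auto
qed

lemma y_power_N1: "y ^ N 1 - y = y * (y ^ (N 1 - 1) - 1)"
proof -
  have "y ^ N 1 = y ^ (N 1 - 1) * y"
    using N_gt_1[OF zero_less_one] by (intro power_minus_mult[symmetric]) linarith
  thus ?thesis by (simp add: algebra_simps)
qed

lemma V0_finite: "z3_finite t K x y V0 V0"
proof -
  interpret V: valring V0 using V0_place by unfold_locales (simp add: place_over_def)
  show ?thesis using V0_place y0 V.mm_V by unfold_locales auto
qed

end

locale z3_origin = z3 t K x y V0 for t K and x y :: "'f::field" and V0
begin

sublocale z3_finite t K x y V0 V0 by (rule V0_finite)

text \<open>
  At the origin \<open>y\<close> itself can play the role of \<open>y\<^sup>N - y\<close>, of which it is a divisor.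
\<close>

lemma uniformizer_y: "uniformizer y"
  by (rule finite_place_uniformizer[OF y_R y0 y_nonzero zero_less_one _ y_power_N1])
    (intro R_diff R_power y_R R_one)

lemma lead_x: "lead y x 2 (- 1)"
proof -
  have "p = (\<Sum>i<Suc (t - 1). y ^ 3 ^ i)" using t by (simp add: p_def p_fun_def)
  also have "\<dots> = y + (\<Sum>i<t - 1. y ^ 3 ^ Suc i)" by (subst sum.lessThan_Suc_shift) simp
  also have "(\<Sum>i<t - 1. y ^ 3 ^ Suc i) = (\<Sum>i<t - 1. y ^ (3 ^ Suc i - 1)) * y"
    unfolding sum_distrib_right by (intro sum.cong refl power_minus_mult[symmetric]) simp
  finally have p: "p = y * (1 + (\<Sum>i<t - 1. y ^ (3 ^ Suc i - 1)))" by (simp add: algebra_simps)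
  define a where "a = (\<Sum>i<t - 1. y ^ (3 ^ Suc i - 1))"
  have pos: "3 ^ Suc i - 1 > (0::nat)" for i using one_less_power[of "3::nat" "Suc i"] by simp
  have a: "a \<in> mm" unfolding a_def by (intro mm_sum mm_power y0 pos)
  have "x * (1 + x ^ (q - 1)) = x ^ q + x" using q_Q(3) by (intro add_self_factor) simp
  also have "\<dots> = - (p ^ 2)" using xq by simp
  also have "p ^ 2 = y ^ 2 * (1 + a * (2 + a))"
    unfolding p a_def[symmetric] by (simp add: power2_eq_square algebra_simps)
  finally have "x / y ^ 2 + 1 \<in> mm"
    using a x0 y_nonzero q_Q(3) V_add[OF V_add[OF V_one V_one] mm_V[OF a]]
    by (intro unit_quotient[of "a * (2 + a)" "x ^ (q - 1)"] mm_mult mm_power) auto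
  thus ?thesis by (simp add: lead_def power_int_minus divide_inverse)
qed

lemma lead_z: "lead y z (int (q + 1)) (- 1)"
proof -
  have "x / y = (x / y ^ 2 + 1) * y - y" using y_nonzero by (simp add: field_simps power2_eq_square)
  also have "\<dots> \<in> mm"
    using lead_x y0 y_V mm_mult mm_diff by (simp add: lead_def power_int_minus divide_inverse)
  finally have xy: "x / y \<in> mm" .
  have z: "z \<in> mm" unfolding z_def by (intro mm_add mm_diff mm_power x0 y0) auto
  have "z * (1 + z ^ (q - 1)) = z ^ q + z" using q_Q(3) by (intro add_self_factor) simp
  also have "\<dots> = - (y ^ (q + 1) * (1 + (x / y) ^ (q + 1)))"
    using hermitian y_nonzero
    by (simp add: power_divide algebra_simps eq_neg_iff_add_eq_0 del: power_Suc)
  finally have "z / y ^ (q + 1) + 1 \<in> mm"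
    using y_nonzero q_Q(3)
    by (intro unit_quotient[of "(x / y) ^ (q + 1)" "z ^ (q - 1)"] mm_power xy z) auto
  moreover have "y powi (- int (q + 1)) = inverse (y ^ (q + 1))"
    by (simp only: power_int_minus power_int_of_nat)
  ultimately show ?thesis unfolding lead_def by (simp only: divide_inverse) simp
qed

lemma lead_mon: "lead y (mon i j k) (int (2 * i + j + (q + 1) * k)) ((- 1) ^ (i + k))"
proof -
  have m: "- 1 \<in> V0" "(- 1) ^ n \<in> V0" for n using V_minus[OF V_one] V_power by auto
  note s = y0 y_nonzero
  note L = lead_mult[OF s lead_mult[OF s lead_power[OF s lead_x m(1), of i] lead_power[OF s lead_self[OF s] V_one, of j] m(2) V_power[OF V_one]]
    lead_power[OF s lead_z m(1), of k] V_mult[OF m(2) V_power[OF V_one]] m(2)]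
  have "int i * 2 + int j * 1 + int k * int (q + 1) = int (2 * i + j + (q + 1) * k)"
    by (simp add: algebra_simps)
  thus ?thesis using L unfolding mon_def by (simp add: power_add mult.commute)
qed

text \<open>
  Since \<open>2i + j < q + 1\<close>, these are expansions in mixed radix.
\<close>

lemma order_inject:
  assumes "2 * i + j + (q + 1) * k = 2 * i' + j' + (q + 1) * k'" "j < 2" "j' < 2" "i < half" "i' < half"
  shows "i = i' \<and> j = j' \<and> k = k'"
proof -
  have "(2 * i + j + (q + 1) * k) div (q + 1) = k" "(2 * i' + j' + (q + 1) * k') div (q + 1) = k'"
    using assms(2-) two_half by (auto intro: div_nat_eqI)
  hence k: "k = k'" using assms(1) by simp
  hence "2 * i + j = 2 * i' + j'" using assms(1) by simp
  thus ?thesis using k assms(2,3) by presburger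
qed

lemma span_lead:
  assumes "g \<in> lincombs {mon i j k | i j k. i < half \<and> j < 2 \<and> wt i j k \<le> w} K" "g \<noteq> 0"
  shows "\<exists>i j k. i < half \<and> j < 2 \<and> wt i j k \<le> w \<and>
    (\<exists>c\<in>K - {0}. lead y g (int (2 * i + j + (q + 1) * k)) c)"
proof -
  define E where "E b e \<longleftrightarrow> (\<exists>i j k. i < half \<and> j < 2 \<and> wt i j k \<le> w \<and> b = mon i j k
      \<and> e = int (2 * i + j + (q + 1) * k))" for b e
  have "\<exists>b\<in>{mon i j k | i j k. i < half \<and> j < 2 \<and> wt i j k \<le> w}. \<exists>e. E b e \<and> (\<exists>c\<in>K - {0}. lead y g e c)"
  proof (rule lincombs_lead[OF y0 y_nonzero K_subring K_V K_nonzero_mult, where E = E])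
    fix b e assume "E b e"
    thus "\<exists>c\<in>K - {0}. lead y b e c" using lead_mon minus_one_K unfolding E_def by blast
  next
    fix b b' e assume "E b e" "E b' e"
    then obtain i j k i' j' k' where "i < half" "j < 2" "b = mon i j k" "e = int (2 * i + j + (q + 1) * k)"
      "i' < half" "j' < 2" "b' = mon i' j' k'" "e = int (2 * i' + j' + (q + 1) * k')" unfolding E_def by blast
    thus "b = b'" using order_inject[of i j k i' j' k'] by (metis of_nat_eq_iff)
  qed (use assms in \<open>auto simp: E_def\<close>)
  thus ?thesis unfolding E_def by blast
qed

end

context z3
begin

text \<open>
  An element of \<open>R\<close> vanishes at a place over the origin precisely if its constant term does. By
  \<open>finite_place_fraction\<close> a function is a power of \<open>y\<close> times a quotient of two elements of \<open>R\<close>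
  with nonzero constant terms, so its order is the same at both places.
\<close>

lemma places_through_origin_subset:
  assumes V: "place_over V" "x \<in> max_ideal V" "y \<in> max_ideal V"
    and V': "place_over V'" "x \<in> max_ideal V'" "y \<in> max_ideal V'"
  shows "V \<subseteq> V'"
proof
  interpret V: z3_finite t K x y V0 V using V by unfold_locales (auto simp: max_ideal_def)
  interpret V': z3_finite t K x y V0 V' using V' by unfold_locales (auto simp: max_ideal_def)
  define S where "S = {g. \<exists>c\<in>K. g - c \<in> max_ideal V \<inter> max_ideal V'}"
  have KS: "c \<in> S" if "c \<in> K" for c
    unfolding S_def using that V.zero_mm V'.zero_mm by (intro CollectI bexI[of _ c]) simp_all
  have "is_subring S" unfolding is_subring_def
  proof (intro conjI ballI)
    show "1 \<in> S" using KS is_subringD(1)[OF K_subring] by blast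
  next
    fix u v assume "u \<in> S" "v \<in> S"
    then obtain c d where cd: "c \<in> K" "d \<in> K" "u - c \<in> V.mm" "u - c \<in> V'.mm" "v - d \<in> V.mm" "v - d \<in> V'.mm"
      unfolding S_def by blast
    have "(u + v) - (c + d) = (u - c) + (v - d)" "(u - v) - (c - d) = (u - c) - (v - d)"
      "u * v - c * d = (u - c) * (v - d) + (c * (v - d) + d * (u - c))"
      by (auto simp: algebra_simps)
    moreover have "c + d \<in> K" "c - d \<in> K" "c * d \<in> K" using is_subringD(3-5)[OF K_subring] cd by blast+
    moreover have "(u - c) + (v - d) \<in> V.mm" "(u - c) - (v - d) \<in> V.mm"
      "(u - c) * (v - d) + (c * (v - d) + d * (u - c)) \<in> V.mm"
      using cd V.K_V by (auto intro!: V.mm_add V.mm_diff V.mm_mult V.mm_mult2 dest: V.mm_V)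
    moreover have "(u - c) + (v - d) \<in> V'.mm" "(u - c) - (v - d) \<in> V'.mm"
      "(u - c) * (v - d) + (c * (v - d) + d * (u - c)) \<in> V'.mm"
      using cd V'.K_V by (auto intro!: V'.mm_add V'.mm_diff V'.mm_mult V'.mm_mult2 dest: V'.mm_V)
    ultimately show "u + v \<in> S" "u - v \<in> S" "u * v \<in> S"
      unfolding S_def mem_Collect_eq Int_iff by metis+
  qed
  moreover have "K \<subseteq> S" using KS by blast
  moreover have "x \<in> S" "y \<in> S" unfolding S_def using is_subringD(2)[OF K_subring] V V'
    by (auto intro!: bexI[of _ 0])
  ultimately have RS: "R \<subseteq> S" by (rule R_least)
  have unit: "U \<in> V'.units" if U: "U \<in> R" "U \<in> V.units" for U
  proof -
    obtain c where c: "c \<in> K" "U - c \<in> V.mm" "U - c \<in> V'.mm" using RS U unfolding S_def by blast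
    have "c \<noteq> 0" using c U by (auto simp: V.units_def)
    hence "c \<in> V'.units" using K_units[OF V'(1)] c by blast
    thus ?thesis using V'.units_add_mm[of c "U - c"] c by simp
  qed
  fix f assume f: "f \<in> V"
  show "f \<in> V'"
  proof (cases "f = 0")
    case True thus ?thesis using V'.V_zero by simp
  next
    case False
    note yN = y_power_N1
    have R: "y ^ (N 1 - 1) - 1 \<in> R" by (intro R_diff R_power y_R R_one)
    obtain j U W where UW: "U \<in> R \<inter> V.units" "W \<in> R \<inter> V.units" "f = y powi j * (U / W)"
      using V.finite_place_fraction[OF y_R V(3) y_nonzero zero_less_one R yN False] by blast
    have "U / W \<in> V.units" using UW V.units_divide by blast
    hence "j \<ge> 0"
      using V.uniformizer_nonneg(1)[OF V.finite_place_uniformizer[OF y_R V(3) y_nonzero zero_less_one R yN]] f UW(3)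
      by blast
    moreover have "U / W \<in> V'.units" using UW unit V'.units_divide by blast
    ultimately show ?thesis
      using V'.uniformizer_nonneg(1)[OF V'.finite_place_uniformizer[OF y_R V'(3) y_nonzero zero_less_one R yN]] UW(3)
      by blast
  qed
qed

lemma place_with_z_zero_is_origin:
  assumes V: "place_over V" "y \<in> V" and z: "z \<in> max_ideal V"
  shows "V = V0"
proof -
  interpret V: z3_finite t K x y V0 V using V by unfold_locales
  have "x \<in> max_ideal V" "y \<in> max_ideal V" using V.z_zero[OF z] by auto
  thus ?thesis using places_through_origin_subset V(1) V0_place x0 y0 by blast
qed

lemma valuation_ring_place_over: "valuation_ring K V \<Longrightarrow> place_over V"
  using valuation_ring_valring by (auto simp: place_over_def valuation_ring_def)

lemma valuation_ring_uniformizer: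
  assumes ring: "valuation_ring K V" shows "\<exists>s. valring.uniformizer V s"
proof (cases "y \<in> V")
  case True
  interpret z3_finite t K x y V0 V
    using valuation_ring_place_over[OF ring] True by unfold_locales
  show ?thesis using exists_uniformizer ring unfolding valuation_ring_def by blast
next
  case False
  interpret z3_infinite t K x y V0 V
    using valuation_ring_place_over[OF ring] False by unfold_locales
  show ?thesis using uniformizer_tau by blast
qed

lemma valuation_ring_val_nonneg:
  assumes "valuation_ring K V" "f \<noteq> 0" shows "place_val (max_ideal V) f \<ge> 0 \<longleftrightarrow> f \<in> V"
  using valring.place_val_nonneg_iff[OF valring.intro[OF valuation_ring_valring[OF assms(1)]]]
    valuation_ring_uniformizer[OF assms(1)] assms(2) by blast

lemma finite_place_valuation_ring:
  assumes "place_over V" "y \<in> V" "V \<noteq> UNIV" shows "valuation_ring K V"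
proof -
  interpret V: valring V using assms by unfold_locales (simp add: place_over_def)
  have "y \<notin> K" using K_units[OF V0_place] y0 y_nonzero
    valring.units_def[OF valring.intro[OF valuation_ring_valring[OF V0]]] by blast
  hence "K \<subset> V" using assms unfolding place_over_def by blast
  moreover have "V \<subset> UNIV" using assms(3) by blast
  ultimately show ?thesis unfolding valuation_ring_def
    by (simp add: V.V_add V.V_diff V.V_mult V.dichotomy)
qed

end

context z3_infinite
begin

text \<open>
  The number of factors \<open>1/z\<close> that makes a function of pole order \<open>w\<close> regular at infinity.
\<close>

lemma quotient_in_V:
  assumes "g \<in> R" "lead \<tau> g (- int w) c" "c \<in> K - {0}"
  shows "g / z ^ k \<in> V \<longleftrightarrow> w \<le> (q + 1) * k"
proof -
  have z: "lead \<tau> (z ^ k) (- int (wt 0 0 k)) ((- 1) ^ k)"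
    using lead_mon[of 0 0 k] by (simp add: mon_def)
  have "g / z ^ k \<in> V \<longleftrightarrow> - int (wt 0 0 k) \<le> - int w"
    by (rule lead_quotient(2)[OF uniformizer_tau assms(2) z K_unit[OF assms(3)] K_unit[OF minus_one_K]])
  thus ?thesis by (simp add: wt_def del: of_nat_add of_nat_mult of_nat_Suc)
qed

end

context z3_origin
begin

lemma K_unit: "c \<in> K - {0} \<Longrightarrow> c \<in> units" using K_units[OF V0_place] by blast

lemma x_nonzero: "x \<noteq> 0" and z_nonzero: "z \<noteq> 0"
proof -
  have "- 1 \<in> units" using K_unit[OF minus_one_K[of 1]] by simp
  thus "x \<noteq> 0" "z \<noteq> 0"
    using lead_exponent_less[OF y0 y_nonzero lead_x, of 2]
      lead_exponent_less[OF y0 y_nonzero lead_z, of "int (q + 1)"]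
    by (auto simp: lead_def zero_mm)
qed

lemma order_quotient:
  assumes "lead y g e c" "c \<in> K - {0}"
  shows "place_val mm (g / z ^ k) = e - int ((q + 1) * k)"
proof -
  have z: "lead y (z ^ k) (int ((q + 1) * k)) ((- 1) ^ k)"
    using lead_mon[of 0 0 k] by (simp add: mon_def)
  show ?thesis
    by (rule lead_quotient(1)[OF uniformizer_y assms(1) z K_unit[OF assms(2)] K_unit[OF minus_one_K]])
qed

lemma z_unit_elsewhere:
  assumes "valuation_ring K V" "V \<noteq> V0" "y \<in> V"
  shows "z \<in> V" "inverse z \<in> V"
proof -
  interpret W: z3_finite t K x y V0 V
    using valuation_ring_place_over[OF assms(1)] assms(3) by unfold_locales
  show z: "z \<in> V" using W.R_V z_R by blast
  have "z \<notin> W.mm" using place_with_z_zero_is_origin[OF W.V assms(3)] assms(2) by blast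
  thus "inverse z \<in> V" using z by (simp add: max_ideal_def)
qed

text \<open>
  The exact order at the origin is prescribed, also for \<open>n = 0\<close>. Orders then add up under
  multiplication, which pole divisors alone do not guarantee.
\<close>

definition pole_only_at_origin :: "nat \<Rightarrow> 'f \<Rightarrow> bool" where
  "pole_only_at_origin n f \<longleftrightarrow> f \<noteq> 0 \<and> place_val mm f = - int n \<and>
     (\<forall>V. valuation_ring K V \<longrightarrow> V \<noteq> V0 \<longrightarrow> f \<in> V)"

lemma pole_only_at_origin_mult:
  assumes "pole_only_at_origin m f" "pole_only_at_origin n g"
  shows "pole_only_at_origin (m + n) (f * g)"
proof -
  have "f * g \<in> V" if "valuation_ring K V" "V \<noteq> V0" for V
    using that assms unfolding pole_only_at_origin_def valuation_ring_def by blast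
  thus ?thesis using assms place_val_mult[OF uniformizer_y, of f g]
    unfolding pole_only_at_origin_def by simp
qed

lemma pole_only_at_origin_monomial:
  assumes w: "Q * (2 * i + 3 * j) \<le> (q + 1) * k" and n: "n + 2 * i + j = (q + 1) * k"
  shows "pole_only_at_origin n (mon i j 0 / z ^ k)"
proof -
  have "place_val mm (mon i j 0 / z ^ k) = int (2 * i + j + (q + 1) * 0) - int ((q + 1) * k)"
    by (rule order_quotient[OF lead_mon minus_one_K])
  hence val: "place_val mm (mon i j 0 / z ^ k) = - int n" unfolding n[symmetric] by simp
  have "mon i j 0 / z ^ k \<in> V" if V: "valuation_ring K V" "V \<noteq> V0" for V
  proof (cases "y \<in> V")
    case True
    interpret W: z3_finite t K x y V0 V
      using valuation_ring_place_over[OF V(1)] True by unfold_locales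
    have "mon i j 0 \<in> V" using W.R_V mon_R by blast
    thus ?thesis using z_unit_elsewhere[OF V True] W.V_mult W.V_power
      by (simp add: divide_inverse power_inverse[symmetric])
  next
    case False
    interpret W: z3_infinite t K x y V0 V
      using valuation_ring_place_over[OF V(1)] False by unfold_locales
    show ?thesis using W.quotient_in_V[OF mon_R W.lead_mon minus_one_K] w by (simp add: wt_def)
  qed
  thus ?thesis using val z_nonzero x_nonzero y_nonzero unfolding pole_only_at_origin_def by (simp add: mon_def)
qed

lemma weierstrass_semigroup_iff:
  assumes "n > 0"
  shows "n \<in> weierstrass_semigroup K mm \<longleftrightarrow> (\<exists>f. pole_only_at_origin n f)"
proof
  assume "n \<in> weierstrass_semigroup K mm"
  then obtain f where f: "f \<noteq> 0" "pole_divisor K f = place_multiple n mm"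
    unfolding weierstrass_semigroup_def by blast
  have pole: "max 0 (- place_val (max_ideal V) f) = (if max_ideal V = mm then int n else 0)"
    if "valuation_ring K V" for V
  proof -
    have "is_place K (max_ideal V)" using that is_place_iff by blast
    thus ?thesis using fun_cong[OF f(2), of "max_ideal V"]
      by (simp add: pole_divisor_def place_multiple_def)
  qed
  have "f \<in> V" if V: "valuation_ring K V" "V \<noteq> V0" for V
  proof -
    have "max_ideal V \<noteq> mm"
      using max_ideal_inject valuation_ring_valring V V0 by blast
    hence "place_val (max_ideal V) f \<ge> 0" using pole[OF V(1)] by (simp add: max_def split: if_splits)
    thus ?thesis using valuation_ring_val_nonneg[OF V(1) f(1)] by blast
  qed
  moreover have "place_val mm f = - int n"
    using pole[OF V0] assms by (simp add: max_def split: if_splits)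
  ultimately show "\<exists>f. pole_only_at_origin n f" using f(1) unfolding pole_only_at_origin_def by blast
next
  assume "\<exists>f. pole_only_at_origin n f"
  then obtain f where f: "f \<noteq> 0" "place_val mm f = - int n"
    "\<And>V. valuation_ring K V \<Longrightarrow> V \<noteq> V0 \<Longrightarrow> f \<in> V" unfolding pole_only_at_origin_def by blast
  have "pole_divisor K f P = place_multiple n mm P" for P
  proof (cases "is_place K P")
    case True
    then obtain V where V: "valuation_ring K V" "P = max_ideal V" using is_place_iff by blast
    show ?thesis
    proof (cases "V = V0")
      case True thus ?thesis using V f(2) \<open>is_place K P\<close>
        by (simp add: pole_divisor_def place_multiple_def)
    next
      case False
      hence "P \<noteq> mm" using max_ideal_inject valuation_ring_valring V V0 by blast
      moreover have "place_val P f \<ge> 0"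
        using valuation_ring_val_nonneg[OF V(1) f(1)] f(3)[OF V(1) False] V(2) by blast
      ultimately show ?thesis by (simp add: pole_divisor_def place_multiple_def)
    qed
  next
    case False
    hence "P \<noteq> mm" using V0 is_place_iff by blast
    thus ?thesis using False by (simp add: pole_divisor_def place_multiple_def)
  qed
  thus "n \<in> weierstrass_semigroup K mm" using f(1) unfolding weierstrass_semigroup_def by blast
qed

text \<open>
  The function \<open>f z\<^sup>n\<close> is regular at all finite places, hence lies in \<open>R\<close>. As \<open>f\<close> is regular at infinity,
  the pole order of \<open>f z\<^sup>n\<close> there is at most \<open>(q+1)n\<close>, and \<open>f z\<^sup>n\<close> is a combination of monomials obeying
  this bound. One of them has the same order at the origin as \<open>f z\<^sup>n\<close>.
\<close>

lemma pole_number_bound: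
  assumes "pole_only_at_origin n f"
  shows "\<exists>i j m. i < half \<and> j < 2 \<and> Q * (2 * i + 3 * j) \<le> (q + 1) * m \<and> n + 2 * i + j = (q + 1) * m"
proof -
  have f: "f \<noteq> 0" "place_val mm f = - int n"
    "\<And>V. valuation_ring K V \<Longrightarrow> V \<noteq> V0 \<Longrightarrow> f \<in> V" using assms unfolding pole_only_at_origin_def by blast+
  define g where "g = f * z ^ n"
  have fg: "f = g / z ^ n" using z_nonzero by (simp add: g_def)
  have g0: "g \<noteq> 0" using f(1) z_nonzero by (simp add: g_def)
  have "place_val mm (z ^ n) = int ((q + 1) * n)"
  proof -
    have "lead y (z ^ n) (int ((q + 1) * n)) ((- 1) ^ n)"
      using lead_mon[of 0 0 n] by (simp add: mon_def)
    from order_quotient[OF this minus_one_K, of 0] show ?thesis by simp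
  qed
  hence "place_val mm g = - int n + int ((q + 1) * n)"
    unfolding g_def using place_val_mult[OF uniformizer_y f(1), of "z ^ n"] z_nonzero f(2) by simp
  hence "place_val mm g \<ge> 0" by (simp add: algebra_simps)
  hence gV0: "g \<in> V0" using valuation_ring_val_nonneg[OF V0 g0] by blast
  have "g \<in> V" if V: "place_over V" "y \<in> V" for V
  proof (cases "V = UNIV \<or> V = V0")
    case True thus ?thesis using gV0 by auto
  next
    case False
    have ring: "valuation_ring K V" using finite_place_valuation_ring[OF V] False by blast
    interpret W: z3_finite t K x y V0 V using V by unfold_locales
    show ?thesis unfolding g_def
      using f(3)[OF ring] z_unit_elsewhere(1)[OF ring _ V(2)] False W.V_mult W.V_power by blast
  qed
  hence gR: "g \<in> R" by (rule regular_outside_infinity_in_R)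
  obtain V where V: "place_over V" "y \<notin> V" using exists_infinite_place by blast
  then interpret W: z3_infinite t K x y V0 V by unfold_locales
  have "V \<noteq> V0" using V(2) y_V by blast
  moreover have "valuation_ring K V"
  proof -
    have "x \<notin> V" "inverse y \<in> V" using W.x_notin_V W.inverse_y W.mm_V by auto
    moreover have "inverse y \<notin> K" using K_inverse[of "inverse y"] V W.K_V by auto
    ultimately show ?thesis unfolding valuation_ring_def using W.K_V
      by (auto simp: W.V_add W.V_diff W.V_mult W.dichotomy)
  qed
  ultimately have "f \<in> V" using f(3) by blast
  obtain i0 j0 k0 c where lead: "c \<in> K - {0}" "W.lead W.\<tau> g (- int (wt i0 j0 k0)) c"
    using W.R_lead[OF gR g0] by blast
  define w where "w = wt i0 j0 k0"
  have w: "w \<le> (q + 1) * n"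
    using W.quotient_in_V[OF gR lead(2,1), of n] \<open>f \<in> V\<close> fg w_def by simp
  have "g \<in> lincombs {mon i j k | i j k. i < half \<and> j < 2 \<and> wt i j k \<le> w} K"
    using W.R_span_by_weight[OF gR g0 lead(2,1)] w_def by simp
  then obtain i j k d where ijk: "i < half" "j < 2" "wt i j k \<le> w" "d \<in> K - {0}"
    "lead y g (int (2 * i + j + (q + 1) * k)) d" using span_lead[OF _ g0] by blast
  have "- int n = int (2 * i + j + (q + 1) * k) - int ((q + 1) * n)"
    using order_quotient[OF ijk(5,4), of n] f(2) fg by simp
  hence n: "n + 2 * i + j + (q + 1) * k = (q + 1) * n" by linarith
  have kw: "Q * (2 * i + 3 * j) + (q + 1) * k \<le> (q + 1) * n" using ijk(3) w by (simp add: wt_def)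
  hence "(q + 1) * k \<le> (q + 1) * n" by linarith
  hence "k \<le> n" by (simp only: mult_le_cancel1)
  then obtain m where m: "n = k + m" using le_Suc_ex by blast
  have "Q * (2 * i + 3 * j) \<le> (q + 1) * m" using kw unfolding m by (simp add: algebra_simps)
  moreover have "n + 2 * i + j = (q + 1) * m" using n unfolding m by (simp add: algebra_simps)
  ultimately show ?thesis using ijk by blast
qed

theorem weierstrass_semigroup_origin:
  "weierstrass_semigroup K mm = generated_submonoid {q, q + 1, q - 1, 2 * q - 4}"
proof
  show "weierstrass_semigroup K mm \<subseteq> generated_submonoid {q, q + 1, q - 1, 2 * q - 4}"
  proof
    fix n assume n: "n \<in> weierstrass_semigroup K mm"
    show "n \<in> generated_submonoid {q, q + 1, q - 1, 2 * q - 4}"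
    proof (cases "n = 0")
      case True thus ?thesis by (simp add: generated_submonoid_closed(1))
    next
      case False
      then obtain f where "pole_only_at_origin n f" using n weierstrass_semigroup_iff by blast
      thus ?thesis using pole_number_bound pole_number_combination by blast
    qed
  qed
next
  define G where "G = {n. \<exists>f. pole_only_at_origin n f}"
  have one: "pole_only_at_origin 0 1"
    using pole_only_at_origin_monomial[of 0 0 0 0] by (simp add: mon_def)
  have "is_submonoid G" unfolding is_submonoid_def G_def
    using one pole_only_at_origin_mult by blast
  moreover have "{q, q + 1, q - 1, 2 * q - 4} \<subseteq> G"
  proof -
    have "pole_only_at_origin q (mon 0 1 0 / z ^ 1)"
      by (rule pole_only_at_origin_monomial) (auto simp: q_Q(1))
    moreover have "pole_only_at_origin (q + 1) (mon 0 0 0 / z ^ 1)"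
      by (rule pole_only_at_origin_monomial) auto
    moreover have "pole_only_at_origin (q - 1) (mon 1 0 0 / z ^ 1)"
      by (rule pole_only_at_origin_monomial) (use q_Q(1-3) in auto)
    moreover have "pole_only_at_origin (2 * q - 4) (mon 3 0 0 / z ^ 2)"
      by (rule pole_only_at_origin_monomial) (use q_Q(1-3) in auto)
    ultimately show ?thesis unfolding G_def by blast
  qed
  ultimately have "generated_submonoid {q, q + 1, q - 1, 2 * q - 4} \<subseteq> G"
    unfolding generated_submonoid_def by (intro hull_minimal)
  moreover have "n \<in> weierstrass_semigroup K mm" if "n \<in> G" for n
  proof (cases "n = 0")
    case True
    have "pole_divisor K 1 = place_multiple 0 mm"
    proof
      fix P show "pole_divisor K 1 P = place_multiple 0 mm P"
      proof (cases "is_place K P")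
        case True
        then obtain V where V: "valuation_ring K V" "P = max_ideal V" using is_place_iff by blast
        have "1 \<in> V" using valring.V_one[OF valring.intro[OF valuation_ring_valring[OF V(1)]]] .
        hence "place_val P 1 \<ge> 0" using valuation_ring_val_nonneg[OF V(1), of 1] V(2) by simp
        thus ?thesis by (auto simp: pole_divisor_def place_multiple_def)
      qed (simp add: pole_divisor_def place_multiple_def)
    qed
    thus ?thesis using True unfolding weierstrass_semigroup_def by (auto intro!: exI[of _ 1])
  next
    case False thus ?thesis using that weierstrass_semigroup_iff unfolding G_def by blast
  qed
  ultimately show "generated_submonoid {q, q + 1, q - 1, 2 * q - 4} \<subseteq> weierstrass_semigroup K mm" by blast
qed

end

section \<open>The Weierstrass semigroup\<close>

lemma adjoin_shift:
  assumes K: "is_subfield K" and a: "a \<in> K" "b \<in> K"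
  shows "adjoin K {x, y} \<subseteq> adjoin K {x - a, y - b}"
  unfolding adjoin_def
proof (rule hull_minimal)
  have sub: "is_subfield (is_subfield hull (K \<union> {x - a, y - b}))"
    by (rule hull_in) (auto simp: is_subfield_def)
  have S: "K \<union> {x - a, y - b} \<subseteq> is_subfield hull (K \<union> {x - a, y - b})" by (rule hull_subset)
  have add: "u + v \<in> is_subfield hull (K \<union> {x - a, y - b})"
    if "u \<in> is_subfield hull (K \<union> {x - a, y - b})" "v \<in> is_subfield hull (K \<union> {x - a, y - b})" for u v
    using sub that unfolding is_subfield_def by blast
  have "(x - a) + a \<in> is_subfield hull (K \<union> {x - a, y - b})"
    "(y - b) + b \<in> is_subfield hull (K \<union> {x - a, y - b})"
    by (rule add; use S a in blast)+
  thus "K \<union> {x, y} \<subseteq> is_subfield hull (K \<union> {x - a, y - b})" using S by simp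
  show "is_subfield (is_subfield hull (K \<union> {x - a, y - b}))" by (rule sub)
qed

theorem theorem2p4:
  fixes K P :: "'f::field set" and x y a b :: 'f and q t :: nat
  assumes "t \<ge> 1" and "q = 3 ^ t"
    and "is_Z3 t K x y"
    and "a \<in> K" and "b \<in> K"
    and "a ^ q + a = 0" and "p_fun t b = 0"
    and "rational_place K P" and "has_value_at K P x a" and "has_value_at K P y b"
  shows "weierstrass_semigroup K P = generated_submonoid {q, q + 1, q - 1, 2 * q - 4}"
proof -
  have Z: "is_subfield K" "card K = (3 ^ t)\<^sup>2" "adjoin K {x, y} = UNIV"
    "x ^ 3 ^ t + x + (p_fun t y)\<^sup>2 = 0"
    using assms(3) by (auto simp: is_Z3_def function_field_def)
  have "finite K" using Z(2) by (metis card.infinite power_not_zero zero_neq_numeral)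
  hence "of_nat (card K) = (0 :: 'f)" by (rule card_subfield_eq_0[OF Z(1)])
  hence three: "(3 :: 'f) = 0" by (simp add: Z(2))
  obtain V where VP: "valuation_ring K V" "P = max_ideal V"
    using assms(8) is_place_iff unfolding rational_place_def by blast
  interpret z3_origin t K "x - a" "y - b" V
  proof unfold_locales
    show "adjoin K {x - a, y - b} = UNIV" using adjoin_shift[OF Z(1) assms(4,5), of x y] Z(3) by blast
    have "(x - a) ^ 3 ^ t + (x - a) + (p_fun t (y - b))\<^sup>2
      = (x ^ 3 ^ t + x + (p_fun t y)\<^sup>2) - (a ^ q + a)"
      using assms(2,7) by (simp add: char3_diff[OF three] p_fun_diff[OF three])
    thus "(x - a) ^ 3 ^ t + (x - a) + (p_fun t (y - b))\<^sup>2 = 0" using Z(4) assms(6) by simp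
    show "x - a \<in> max_ideal V" "y - b \<in> max_ideal V"
      using assms(9,10) VP(2) by (auto simp: has_value_at_def)
  qed (use assms(1) Z VP in auto)
  show ?thesis using weierstrass_semigroup_origin VP(2) q_def assms(2) by simp
qed

end
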